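(* Suppose $\sup_{a\in\mathcal A}\mathrm{Var}(Y(a))\le\sigma_Y^2$ for a constant $\sigma_Y^2$, and unconfoundedness $A_t\perp\{Y_t(a)\}_{a\in\mathcal A}\mid(\mathcal H_{t-1},X_t)$ holds for all $t$. Let $\mu_a^*=\mathbb E[Y(a)]$, $a^*=\arg\max_a\mu_a^*$, and suppose the suboptimality gap satisfies $\Delta=\mu_{a^*}^*-\max_{a'\ne a^*}\mu_{a'}^*>0$. Then each of the following three behavior policies (when it is the policy used to collect the data) converges, i.e. there is a stationary policy $\bar\pi:\mathcal X\to\Delta(\mathcal A)$ such that $\pi_t(a\mid X_t,\mathcal H_{t-1})-\bar\pi(a\mid X_t)\xrightarrow{p}0$ as $t\to\infty$ for every $a\in\mathcal A$: (a) $\epsilon$-greedy: $\pi_t(a\mid\mathcal H_{t-1})=1-\frac{K-1}K\epsilon$ if $a=\arg\max_i\hat\mu_{i,t-1}$, and $\epsilon/K$ otherwise; (b) UCB: $\pi_t(a\mid\mathcal H_{t-1})=1-(K-1)\pi_{\min}$ if $a=\arg\max_i\{\hat\mu_{i,t-1}+\sqrt{C_t/N_{i,t-1}}\}$, and $\pi_{\min}$ otherwise, where $\{C_t\}_{t\ge1}$ is any deterministic sequence with $\lim_{t\to\infty}C_t/t=0$; (c) Thompson sampling: $(\pi_t(a\mid\mathcal H_{t-1}))_{a\in\mathcal A}=\mathrm{Clip}\big((\bar\pi_t^{TS}(a\mid\mathcal H_{t-1}))_{a\in\mathcal A}\big)$, where $\bar\pi_t^{TS}(a\mid\mathcal H_{t-1})$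 is the probability that $\mu_i'<\mu_a'$ for all $i\ne a$ when $(\mu_i')_{i\in\mathcal A}\sim\mathcal N(\mu_{t-1}^{\mathrm{post}},\Sigma_{t-1}^{\mathrm{post}})$, with $\mu_{t}^{\mathrm{post}}=(\mu_{a,t}^{\mathrm{post}})_{a}$, $\Sigma_{t}^{\mathrm{post}}=\mathrm{diag}((\sigma_{a,t}^{\mathrm{post}})^2)$, $$\mu_{a,t}^{\mathrm{post}}=\Big(\frac1{\sigma_0^2}+\frac{N_{a,t}}{\sigma^2}\Big)^{-1}\Big(\frac{\mu_0}{\sigma_0^2}+\frac{N_{a,t}\hat\mu_{a,t}}{\sigma^2}\Big),\qquad(\sigma_{a,t}^{\mathrm{post}})^2=\Big(\frac1{\sigma_0^2}+\frac{N_{a,t}}{\sigma^2}\Big)^{-1},$$ and $\mu_0\in\mathbb R$, $\sigma^2,\sigma_0^2>0$ fixed.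
   Context: Contextual bandit setting. Contexts $X_t\in\mathcal X\subseteq\mathbb R^{d_X}$, finite action set $\mathcal A=\{1,\dots,K\}$, potential outcomes $Y_t(a)\in\mathbb R$; the tuples $(X_t,\{Y_t(a)\}_{a\in\mathcal A})$, $t\ge1$, are i.i.d., with generic copy $(X,\{Y(a)\})$. At time $t$, given the history $\mathcal H_{t-1}=\{X_\tau,\pi_\tau,A_\tau,Y_\tau\}_{\tau<t}$ and $X_t$, the action $A_t$ is drawn from the behavior policy $\pi_t(\cdot\mid X_t,\mathcal H_{t-1})\in\Delta(\mathcal A)$, and $Y_t=Y_t(A_t)$ is observed. The tuple $(X_t,\{Y_t(a)\}_a)$ is independent of $\mathcal H_{t-1}$. $N_{a,t}=\sum_{\tau=1}^t1_{\{A_\tau=a\}}$ and $\hat\mu_{a,t}=N_{a,t}^{-1}\sum_{\tau=1}^t1_{\{A_\tau=a\}}Y_\tau$ (arbitrary convention when $N_{a,t}=0$; ties in $\arg\max$ are broken arbitrarily). Here $\epsilon\in(0,1)$ and $\pi_{\min}\in(0,1/K)$ are fixed constants. Clipping map: for $\boldsymbol\pi\in[0,1]^K$, $\mathrm{Clip}(\boldsymbol\pi)_a=\max\{\boldsymbol\pi_a-\nu^*(\boldsymbol\pi),\pi_{\min}\}$, where $\nu^*(\boldsymbol\pi)$ is the unique $\nu$ with $\sum_{a\in\mathcal A}\max\{\boldsymbol\pi_a-\nu,\pi_{\min}\}=1$. *)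

theory Defs
  imports "HOL-Probability.Probability"
begin

section \<open>Contextual bandit data\<close>

text \<open>
  Conventions: the actions are the naturals in \<open>{1..K}\<close>; time starts at \<open>t = 1\<close> and the values of
  all processes at index \<open>0\<close> are irrelevant.  \<open>Y t a \<omega>\<close> is the potential outcome of action \<open>a\<close>, and
  \<open>\<pi> t \<omega> a\<close> is the realised probability \<open>\<pi>\<^sub>t(a | X\<^sub>t, H\<^sub>t\<^sub>-\<^sub>1)\<close>.
\<close>

definition potential_space :: "nat \<Rightarrow> (nat \<Rightarrow> real) measure" where
  "potential_space K = PiM {1..K} (\<lambda>_. borel)"

definition potentials :: "nat \<Rightarrow> (nat \<Rightarrow> nat \<Rightarrow> 'w \<Rightarrow> real) \<Rightarrow> nat \<Rightarrow> 'w \<Rightarrow> nat \<Rightarrow> real" where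
  "potentials K Y t \<omega> = (\<lambda>a\<in>{1..K}. Y t a \<omega>)"

definition obs_outcome ::
  "(nat \<Rightarrow> nat \<Rightarrow> 'w \<Rightarrow> real) \<Rightarrow> (nat \<Rightarrow> 'w \<Rightarrow> nat) \<Rightarrow> nat \<Rightarrow> 'w \<Rightarrow> real" where
  "obs_outcome Y A t \<omega> = Y t (A t \<omega>) \<omega>"

definition prob_simplex :: "nat \<Rightarrow> (nat \<Rightarrow> real) set" where
  "prob_simplex K = {p. (\<forall>a\<in>{1..K}. 0 \<le> p a) \<and> (\<Sum>a=1..K. p a) = 1}"

text \<open>
  \<open>history K X \<pi> A Y n\<close> is \<open>H\<^sub>n\<close>, the record of \<open>(X\<^sub>\<tau>, \<pi>\<^sub>\<tau>, A\<^sub>\<tau>, Y\<^sub>\<tau>)\<close> for \<open>1 \<le> \<tau> \<le> n\<close>, so that the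
  information available before round \<open>t\<close> is \<open>history K X \<pi> A Y (t - 1)\<close>; \<open>\<pi>\<^sub>\<tau>\<close> is recorded as the
  vector of its realised action probabilities.
\<close>

definition history_space ::
  "nat \<Rightarrow> nat \<Rightarrow> (nat \<Rightarrow> 'x::euclidean_space \<times> (nat \<Rightarrow> real) \<times> nat \<times> real) measure" where
  "history_space K n =
     PiM {1..n} (\<lambda>_. borel \<Otimes>\<^sub>M (PiM {1..K} (\<lambda>_. borel) \<Otimes>\<^sub>M (count_space {1..K} \<Otimes>\<^sub>M borel)))"

definition history ::
  "nat \<Rightarrow> (nat \<Rightarrow> 'w \<Rightarrow> 'x::euclidean_space) \<Rightarrow> (nat \<Rightarrow> 'w \<Rightarrow> nat \<Rightarrow> real) \<Rightarrow> (nat \<Rightarrow> 'w \<Rightarrow> nat)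
     \<Rightarrow> (nat \<Rightarrow> nat \<Rightarrow> 'w \<Rightarrow> real) \<Rightarrow> nat \<Rightarrow> 'w \<Rightarrow> nat \<Rightarrow> 'x \<times> (nat \<Rightarrow> real) \<times> nat \<times> real" where
  "history K X \<pi> A Y n \<omega> =
     (\<lambda>\<tau>\<in>{1..n}. (X \<tau> \<omega>, (\<lambda>a\<in>{1..K}. \<pi> \<tau> \<omega> a), A \<tau> \<omega>, obs_outcome Y A \<tau> \<omega>))"

text \<open>The sub-sigma-algebras generated by \<open>H\<^sub>n\<close> and, respectively, by \<open>(H\<^sub>t\<^sub>-\<^sub>1, X\<^sub>t)\<close>.\<close>

definition hist_alg ::
  "'w measure \<Rightarrow> nat \<Rightarrow> (nat \<Rightarrow> 'w \<Rightarrow> 'x::euclidean_space) \<Rightarrow> (nat \<Rightarrow> 'w \<Rightarrow> nat \<Rightarrow> real)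
     \<Rightarrow> (nat \<Rightarrow> 'w \<Rightarrow> nat) \<Rightarrow> (nat \<Rightarrow> nat \<Rightarrow> 'w \<Rightarrow> real) \<Rightarrow> nat \<Rightarrow> 'w measure" where
  "hist_alg M K X \<pi> A Y n = vimage_algebra (space M) (history K X \<pi> A Y n) (history_space K n)"

definition hist_ctx_alg ::
  "'w measure \<Rightarrow> nat \<Rightarrow> (nat \<Rightarrow> 'w \<Rightarrow> 'x::euclidean_space) \<Rightarrow> (nat \<Rightarrow> 'w \<Rightarrow> nat \<Rightarrow> real)
     \<Rightarrow> (nat \<Rightarrow> 'w \<Rightarrow> nat) \<Rightarrow> (nat \<Rightarrow> nat \<Rightarrow> 'w \<Rightarrow> real) \<Rightarrow> nat \<Rightarrow> 'w measure" where
  "hist_ctx_alg M K X \<pi> A Y t =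
     vimage_algebra (space M) (\<lambda>\<omega>. (history K X \<pi> A Y (t - 1) \<omega>, X t \<omega>))
       (history_space K (t - 1) \<Otimes>\<^sub>M borel)"

locale contextual_bandit = prob_space M
  for M :: "'w measure" +
  fixes K :: nat
    and \<X> :: "'x::euclidean_space set"
    and X :: "nat \<Rightarrow> 'w \<Rightarrow> 'x"
    and Y :: "nat \<Rightarrow> nat \<Rightarrow> 'w \<Rightarrow> real"
    and A :: "nat \<Rightarrow> 'w \<Rightarrow> nat"
    and \<pi> :: "nat \<Rightarrow> 'w \<Rightarrow> nat \<Rightarrow> real"
  assumes K_pos: "1 \<le> K"
    and X_measurable: "t \<ge> 1 \<Longrightarrow> X t \<in> borel_measurable M"
    and X_in: "t \<ge> 1 \<Longrightarrow> \<omega> \<in> space M \<Longrightarrow> X t \<omega> \<in> \<X>"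
    and Y_measurable: "t \<ge> 1 \<Longrightarrow> a \<in> {1..K} \<Longrightarrow> Y t a \<in> borel_measurable M"
    and tuples_indep:
      "indep_vars (\<lambda>_. borel \<Otimes>\<^sub>M potential_space K) (\<lambda>t \<omega>. (X t \<omega>, potentials K Y t \<omega>)) {1..}"
    and tuples_ident:
      "t \<ge> 1 \<Longrightarrow>
         distr M (borel \<Otimes>\<^sub>M potential_space K) (\<lambda>\<omega>. (X t \<omega>, potentials K Y t \<omega>))
       = distr M (borel \<Otimes>\<^sub>M potential_space K) (\<lambda>\<omega>. (X 1 \<omega>, potentials K Y 1 \<omega>))"
    and A_measurable: "t \<ge> 1 \<Longrightarrow> A t \<in> measurable M (count_space {1..K})"
    and policy_simplex: "t \<ge> 1 \<Longrightarrow> \<omega> \<in> space M \<Longrightarrow> \<pi> t \<omega> \<in> prob_simplex K"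
    and policy_adapted:
      "t \<ge> 1 \<Longrightarrow> a \<in> {1..K} \<Longrightarrow> (\<lambda>\<omega>. \<pi> t \<omega> a) \<in> borel_measurable (hist_ctx_alg M K X \<pi> A Y t)"
    and action_drawn:
      "t \<ge> 1 \<Longrightarrow> a \<in> {1..K} \<Longrightarrow>
         AE \<omega> in M. real_cond_exp M (hist_ctx_alg M K X \<pi> A Y t)
                      (indicator {\<omega> \<in> space M. A t \<omega> = a}) \<omega> = \<pi> t \<omega> a"
    and tuple_indep_history:
      "t \<ge> 1 \<Longrightarrow>
         indep_set
           (sets (vimage_algebra (space M) (\<lambda>\<omega>. (X t \<omega>, potentials K Y t \<omega>))
                   (borel \<Otimes>\<^sub>M potential_space K)))
           (sets (hist_alg M K X \<pi> A Y (t - 1)))"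

text \<open>Mean of the generic copy; the tuples are identically distributed, so round 1 represents it.\<close>

definition arm_mean :: "'w measure \<Rightarrow> (nat \<Rightarrow> nat \<Rightarrow> 'w \<Rightarrow> real) \<Rightarrow> nat \<Rightarrow> real" where
  "arm_mean M Y a = prob_space.expectation M (Y 1 a)"

definition cond_indep_alg :: "'w measure \<Rightarrow> 'w measure \<Rightarrow> 'w measure \<Rightarrow> 'w measure \<Rightarrow> bool" where
  "cond_indep_alg M F G H \<longleftrightarrow>
     (\<forall>B\<in>sets G. \<forall>D\<in>sets H. AE \<omega> in M.
        real_cond_exp M F (indicator (B \<inter> D)) \<omega>
      = real_cond_exp M F (indicator B) \<omega> * real_cond_exp M F (indicator D) \<omega>)"

definition unconfounded ::
  "'w measure \<Rightarrow> nat \<Rightarrow> (nat \<Rightarrow> 'w \<Rightarrow> 'x::euclidean_space) \<Rightarrow> (nat \<Rightarrow> nat \<Rightarrow> 'w \<Rightarrow> real)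
     \<Rightarrow> (nat \<Rightarrow> 'w \<Rightarrow> nat) \<Rightarrow> (nat \<Rightarrow> 'w \<Rightarrow> nat \<Rightarrow> real) \<Rightarrow> bool" where
  "unconfounded M K X Y A \<pi> \<longleftrightarrow>
     (\<forall>t\<ge>1. cond_indep_alg M (hist_ctx_alg M K X \<pi> A Y t)
        (vimage_algebra (space M) (A t) (count_space {1..K}))
        (vimage_algebra (space M) (potentials K Y t) (potential_space K)))"


section \<open>Convergence of a behavior policy\<close>

definition conv_in_prob :: "'w measure \<Rightarrow> (nat \<Rightarrow> 'w \<Rightarrow> real) \<Rightarrow> ('w \<Rightarrow> real) \<Rightarrow> bool" where
  "conv_in_prob M Z W \<longleftrightarrow>
     (\<forall>e>0. (\<lambda>t. measure M {\<omega> \<in> space M. \<bar>Z t \<omega> - W \<omega>\<bar> > e}) \<longlonglongrightarrow> 0)"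

definition stationary_policy ::
  "nat \<Rightarrow> 'x::euclidean_space set \<Rightarrow> ('x \<Rightarrow> nat \<Rightarrow> real) \<Rightarrow> bool" where
  "stationary_policy K \<X> \<rho> \<longleftrightarrow>
     (\<forall>x\<in>\<X>. \<rho> x \<in> prob_simplex K) \<and>
     (\<forall>a\<in>{1..K}. (\<lambda>x. \<rho> x a) \<in> borel_measurable (restrict_space borel \<X>))"

definition policy_converges ::
  "'w measure \<Rightarrow> nat \<Rightarrow> 'x::euclidean_space set \<Rightarrow> (nat \<Rightarrow> 'w \<Rightarrow> 'x)
     \<Rightarrow> (nat \<Rightarrow> 'w \<Rightarrow> nat \<Rightarrow> real) \<Rightarrow> bool" where
  "policy_converges M K \<X> X \<pi> \<longleftrightarrow>
     (\<exists>\<rho>. stationary_policy K \<X> \<rho> \<and>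
        (\<forall>a\<in>{1..K}. conv_in_prob M (\<lambda>t \<omega>. \<pi> t \<omega> a - \<rho> (X t \<omega>) a) (\<lambda>_. 0)))"


section \<open>The three behavior policies\<close>

definition pull_count :: "(nat \<Rightarrow> 'w \<Rightarrow> nat) \<Rightarrow> nat \<Rightarrow> nat \<Rightarrow> 'w \<Rightarrow> real" where
  "pull_count A a t \<omega> = (\<Sum>\<tau>=1..t. of_bool (A \<tau> \<omega> = a))"

text \<open>
  The parameter \<open>c\<close> is the arbitrary convention in force while action \<open>a\<close> has not been played.  It is
  allowed to depend on the sample point, so that taking \<open>c\<close> larger than every other value covers
  the convention \<open>+\<infinity>\<close> (play each unplayed action first).
\<close>

definition sample_mean ::
  "(nat \<Rightarrow> nat \<Rightarrow> 'w \<Rightarrow> real) \<Rightarrow> (nat \<Rightarrow> nat \<Rightarrow> 'w \<Rightarrow> real) \<Rightarrow> (nat \<Rightarrow> 'w \<Rightarrow> nat)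
     \<Rightarrow> nat \<Rightarrow> nat \<Rightarrow> 'w \<Rightarrow> real" where
  "sample_mean c Y A a t \<omega> =
     (if pull_count A a t \<omega> = 0 then c a t \<omega>
      else (\<Sum>\<tau>=1..t. of_bool (A \<tau> \<omega> = a) * obs_outcome Y A \<tau> \<omega>) / pull_count A a t \<omega>)"

definition ucb_index ::
  "(nat \<Rightarrow> nat \<Rightarrow> 'w \<Rightarrow> real) \<Rightarrow> (nat \<Rightarrow> nat \<Rightarrow> 'w \<Rightarrow> real) \<Rightarrow> (nat \<Rightarrow> 'w \<Rightarrow> nat)
     \<Rightarrow> (nat \<Rightarrow> real) \<Rightarrow> nat \<Rightarrow> nat \<Rightarrow> 'w \<Rightarrow> real" where
  "ucb_index c Y A C a t \<omega> =
     (if pull_count A a (t - 1) \<omega> = 0 then c a (t - 1) \<omega>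
      else sample_mean c Y A a (t - 1) \<omega> + sqrt (C t / pull_count A a (t - 1) \<omega>))"

text \<open>
  Policies written \<open>\<pi>\<^sub>t(a | H\<^sub>t\<^sub>-\<^sub>1)\<close> do not look at the current context.  For \<open>\<epsilon>\<close>-greedy and UCB this
  says that ties in the argmax are broken by an arbitrary measurable rule depending on the history.
\<close>

definition history_based ::
  "'w measure \<Rightarrow> nat \<Rightarrow> (nat \<Rightarrow> 'w \<Rightarrow> 'x::euclidean_space) \<Rightarrow> (nat \<Rightarrow> nat \<Rightarrow> 'w \<Rightarrow> real)
     \<Rightarrow> (nat \<Rightarrow> 'w \<Rightarrow> nat) \<Rightarrow> (nat \<Rightarrow> 'w \<Rightarrow> nat \<Rightarrow> real) \<Rightarrow> bool" where
  "history_based M K X Y A \<pi> \<longleftrightarrow>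
     (\<forall>t\<ge>1. \<forall>a\<in>{1..K}. (\<lambda>\<omega>. \<pi> t \<omega> a) \<in> borel_measurable (hist_alg M K X \<pi> A Y (t - 1)))"

definition eps_greedy ::
  "'w measure \<Rightarrow> nat \<Rightarrow> (nat \<Rightarrow> 'w \<Rightarrow> 'x::euclidean_space) \<Rightarrow> (nat \<Rightarrow> nat \<Rightarrow> 'w \<Rightarrow> real)
     \<Rightarrow> (nat \<Rightarrow> 'w \<Rightarrow> nat) \<Rightarrow> (nat \<Rightarrow> 'w \<Rightarrow> nat \<Rightarrow> real)
     \<Rightarrow> (nat \<Rightarrow> nat \<Rightarrow> 'w \<Rightarrow> real) \<Rightarrow> real \<Rightarrow> bool" where
  "eps_greedy M K X Y A \<pi> c \<epsilon> \<longleftrightarrow>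
     history_based M K X Y A \<pi> \<and>
     (\<forall>t\<ge>1. \<forall>\<omega>\<in>space M. \<exists>g.
        is_arg_max (\<lambda>i. sample_mean c Y A i (t - 1) \<omega>) (\<lambda>i. i \<in> {1..K}) g \<and>
        (\<forall>a\<in>{1..K}. \<pi> t \<omega> a =
           (if a = g then 1 - (real K - 1) / real K * \<epsilon> else \<epsilon> / real K)))"

definition ucb_policy ::
  "'w measure \<Rightarrow> nat \<Rightarrow> (nat \<Rightarrow> 'w \<Rightarrow> 'x::euclidean_space) \<Rightarrow> (nat \<Rightarrow> nat \<Rightarrow> 'w \<Rightarrow> real)
     \<Rightarrow> (nat \<Rightarrow> 'w \<Rightarrow> nat) \<Rightarrow> (nat \<Rightarrow> 'w \<Rightarrow> nat \<Rightarrow> real)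
     \<Rightarrow> (nat \<Rightarrow> nat \<Rightarrow> 'w \<Rightarrow> real) \<Rightarrow> (nat \<Rightarrow> real) \<Rightarrow> real \<Rightarrow> bool" where
  "ucb_policy M K X Y A \<pi> c C \<pi>min \<longleftrightarrow>
     history_based M K X Y A \<pi> \<and>
     (\<forall>t\<ge>1. \<forall>\<omega>\<in>space M. \<exists>g.
        is_arg_max (\<lambda>i. ucb_index c Y A C i t \<omega>) (\<lambda>i. i \<in> {1..K}) g \<and>
        (\<forall>a\<in>{1..K}. \<pi> t \<omega> a = (if a = g then 1 - (real K - 1) * \<pi>min else \<pi>min)))"

definition clip_level :: "nat \<Rightarrow> real \<Rightarrow> (nat \<Rightarrow> real) \<Rightarrow> real" where
  "clip_level K \<pi>min p = (THE \<nu>. (\<Sum>a=1..K. max (p a - \<nu>) \<pi>min) = 1)"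

definition clip :: "nat \<Rightarrow> real \<Rightarrow> (nat \<Rightarrow> real) \<Rightarrow> nat \<Rightarrow> real" where
  "clip K \<pi>min p a = max (p a - clip_level K \<pi>min p) \<pi>min"

definition post_var ::
  "(nat \<Rightarrow> 'w \<Rightarrow> nat) \<Rightarrow> real \<Rightarrow> real \<Rightarrow> nat \<Rightarrow> nat \<Rightarrow> 'w \<Rightarrow> real" where
  "post_var A \<sigma>0 \<sigma> a t \<omega> = inverse (1 / \<sigma>0\<^sup>2 + pull_count A a t \<omega> / \<sigma>\<^sup>2)"

definition post_mean ::
  "(nat \<Rightarrow> nat \<Rightarrow> 'w \<Rightarrow> real) \<Rightarrow> (nat \<Rightarrow> nat \<Rightarrow> 'w \<Rightarrow> real) \<Rightarrow> (nat \<Rightarrow> 'w \<Rightarrow> nat)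
     \<Rightarrow> real \<Rightarrow> real \<Rightarrow> real \<Rightarrow> nat \<Rightarrow> nat \<Rightarrow> 'w \<Rightarrow> real" where
  "post_mean c Y A \<mu>0 \<sigma>0 \<sigma> a t \<omega> =
     inverse (1 / \<sigma>0\<^sup>2 + pull_count A a t \<omega> / \<sigma>\<^sup>2)
       * (\<mu>0 / \<sigma>0\<^sup>2 + pull_count A a t \<omega> * sample_mean c Y A a t \<omega> / \<sigma>\<^sup>2)"

text \<open>
  The normal law on the \<open>K\<close>-dimensional space with mean vector \<open>m\<close> and diagonal covariance matrix
  with entries \<open>v i\<close>; note that \<^const>\<open>normal_density\<close> takes the standard deviation.
\<close>

definition normal_diag :: "nat \<Rightarrow> (nat \<Rightarrow> real) \<Rightarrow> (nat \<Rightarrow> real) \<Rightarrow> (nat \<Rightarrow> real) measure" where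
  "normal_diag K m v =
     PiM {1..K} (\<lambda>i. density lborel (\<lambda>y. ennreal (normal_density (m i) (sqrt (v i)) y)))"

definition ts_prob ::
  "nat \<Rightarrow> (nat \<Rightarrow> nat \<Rightarrow> 'w \<Rightarrow> real) \<Rightarrow> (nat \<Rightarrow> nat \<Rightarrow> 'w \<Rightarrow> real) \<Rightarrow> (nat \<Rightarrow> 'w \<Rightarrow> nat)
     \<Rightarrow> real \<Rightarrow> real \<Rightarrow> real \<Rightarrow> nat \<Rightarrow> 'w \<Rightarrow> nat \<Rightarrow> real" where
  "ts_prob K c Y A \<mu>0 \<sigma>0 \<sigma> t \<omega> a =
     (let P = normal_diag K (\<lambda>i. post_mean c Y A \<mu>0 \<sigma>0 \<sigma> i (t - 1) \<omega>)
                            (\<lambda>i. post_var A \<sigma>0 \<sigma> i (t - 1) \<omega>)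
      in measure P {m \<in> space P. \<forall>i\<in>{1..K} - {a}. m i < m a})"

definition thompson_policy ::
  "'w measure \<Rightarrow> nat \<Rightarrow> (nat \<Rightarrow> 'w \<Rightarrow> 'x::euclidean_space) \<Rightarrow> (nat \<Rightarrow> nat \<Rightarrow> 'w \<Rightarrow> real)
     \<Rightarrow> (nat \<Rightarrow> 'w \<Rightarrow> nat) \<Rightarrow> (nat \<Rightarrow> 'w \<Rightarrow> nat \<Rightarrow> real)
     \<Rightarrow> (nat \<Rightarrow> nat \<Rightarrow> 'w \<Rightarrow> real) \<Rightarrow> real \<Rightarrow> real \<Rightarrow> real \<Rightarrow> real \<Rightarrow> bool" where
  "thompson_policy M K X Y A \<pi> c \<mu>0 \<sigma>0 \<sigma> \<pi>min \<longleftrightarrow>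
     history_based M K X Y A \<pi> \<and>
     (\<forall>t\<ge>1. \<forall>\<omega>\<in>space M. \<forall>a\<in>{1..K}.
        \<pi> t \<omega> a = clip K \<pi>min (ts_prob K c Y A \<mu>0 \<sigma>0 \<sigma> t \<omega>) a)"

end

theory Submission
  imports Defs
begin

text \<open>
  Every arm is played with conditional probability bounded below, and the played indicators minus
  these probabilities are orthogonal, so by Chebyshev's inequality each arm is played a positive
  fraction of the time, up to an event of vanishing probability.  Because the policies do not look
  at the current context, unconfoundedness makes the pair of the history and the chosen action
  independent of the current potential outcomes; hence the centred rewards of each arm are
  orthogonal as well and the sample means concentrate.  On this event all three policies are, for
  large \<open>t\<close>, \<^emph>\<open>equal\<close> to the policy that puts the minimal probability on every suboptimal arm.
\<close>

section \<open>Weak laws and independence\<close>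

text \<open>The centred reward of a round need not have conditional mean zero given the history and
  the context, because \<open>Y t a\<close> may depend on \<open>X t\<close>. The orthogonality
  argument therefore has to condition on the history and the chosen action alone, whereas
  unconfoundedness is stated with the context included. \<open>action_Hist_indep_Pot\<close> bridges
  this gap, and it is there that a policy measurable in the history alone is used. The play counts
  are easier: their compensators are the policy values themselves.

  Since only convergence in probability is claimed, uncorrelatedness and bounded second moments
  suffice. Probability and policies meet in a single event, \<open>good_event\<close>; on it each
  policy is treated pointwise by deterministic estimates whose tolerances are fractions of the gap.
  The common limit vector has mass \<open>q\<close> on every arm but the best, where
  \<open>q\<close> is \<epsilon>/K for the greedy policy and \<pi>min for the other two.\<close>

context prob_space
begin

lemma square_integrable_mult:
  fixes f g :: "'a \<Rightarrow> real"
  assumes [measurable]: "f \<in> borel_measurable M" "g \<in> borel_measurable M"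
    and f: "integrable M (\<lambda>x. (f x)\<^sup>2)" and g: "integrable M (\<lambda>x. (g x)\<^sup>2)"
  shows "integrable M (\<lambda>x. f x * g x)"
proof (rule Bochner_Integration.integrable_bound)
  show "integrable M (\<lambda>x. (f x)\<^sup>2 + (g x)\<^sup>2)"
    using f g by simp
  have "\<bar>f x * g x\<bar> \<le> (f x)\<^sup>2 + (g x)\<^sup>2" for x
    using sum_squares_bound[of "\<bar>f x\<bar>" "\<bar>g x\<bar>"] mult_nonneg_nonneg[of "\<bar>f x\<bar>" "\<bar>g x\<bar>"]
    unfolding abs_mult power2_abs mult.assoc by linarith
  then show "AE x in M. norm (f x * g x) \<le> norm ((f x)\<^sup>2 + (g x)\<^sup>2)"
    by auto
qed simp

text \<open>Induction on \<open>t\<close>: the cross term between the partial sum and the new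
  summand is a sum of vanishing pairwise expectations, so second moments simply add up.\<close>

lemma orthogonal_second_moment_le:
  fixes U :: "nat \<Rightarrow> 'a \<Rightarrow> real"
  assumes [measurable]: "\<And>t. t \<ge> 1 \<Longrightarrow> U t \<in> borel_measurable M"
    and int: "\<And>t. t \<ge> 1 \<Longrightarrow> integrable M (\<lambda>x. (U t x)\<^sup>2)"
    and V: "\<And>t. t \<ge> 1 \<Longrightarrow> expectation (\<lambda>x. (U t x)\<^sup>2) \<le> V"
    and orth: "\<And>s t. 1 \<le> s \<Longrightarrow> s < t \<Longrightarrow> expectation (\<lambda>x. U s x * U t x) = 0"
  shows "integrable M (\<lambda>x. (\<Sum>\<tau>=1..t. U \<tau> x)\<^sup>2)"
    and "expectation (\<lambda>x. (\<Sum>\<tau>=1..t. U \<tau> x)\<^sup>2) \<le> real t * V"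
proof (induction t)
  case (Suc t)
  let ?S = "\<lambda>x. \<Sum>\<tau>=1..t. U \<tau> x"
  have UU: "integrable M (\<lambda>x. U s x * U (Suc t) x)" if "s \<in> {1..t}" for s
    using that by (intro square_integrable_mult int) auto
  have SU: "integrable M (\<lambda>x. ?S x * U (Suc t) x)"
    unfolding sum_distrib_right by (intro Bochner_Integration.integrable_sum UU)
  have "expectation (\<lambda>x. ?S x * U (Suc t) x) = (\<Sum>s=1..t. expectation (\<lambda>x. U s x * U (Suc t) x))"
    unfolding sum_distrib_right by (rule Bochner_Integration.integral_sum[OF UU])
  then have zero: "expectation (\<lambda>x. ?S x * U (Suc t) x) = 0"
    using orth by simp
  have eq: "(\<lambda>x. (\<Sum>\<tau>=1..Suc t. U \<tau> x)\<^sup>2) = (\<lambda>x. (?S x)\<^sup>2 + (2 * (?S x * U (Suc t) x) + (U (Suc t) x)\<^sup>2))"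
    by (auto simp: power2_eq_square algebra_simps)
  {
    case 1
    show ?case unfolding eq
      using Suc SU int[of "Suc t"] by (intro Bochner_Integration.integrable_add) auto
  next
    case 2
    have "expectation (\<lambda>x. (\<Sum>\<tau>=1..Suc t. U \<tau> x)\<^sup>2)
        = expectation (\<lambda>x. (?S x)\<^sup>2) + (2 * 0 + expectation (\<lambda>x. (U (Suc t) x)\<^sup>2))"
      unfolding eq zero[symmetric] using Suc SU int[of "Suc t"] by simp
    also have "\<dots> \<le> real t * V + V"
      using Suc V[of "Suc t"] by simp
    finally show ?case by (simp add: algebra_simps)
  }
qed auto

text \<open>A second moment of order t against the squared threshold of order t^2 leaves a bound of
  order 1/t.\<close>

lemma weak_law_orthogonal:
  fixes U :: "nat \<Rightarrow> 'a \<Rightarrow> real"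
  assumes [measurable]: "\<And>t. t \<ge> 1 \<Longrightarrow> U t \<in> borel_measurable M"
    and int: "\<And>t. t \<ge> 1 \<Longrightarrow> integrable M (\<lambda>x. (U t x)\<^sup>2)"
    and V: "\<And>t. t \<ge> 1 \<Longrightarrow> expectation (\<lambda>x. (U t x)\<^sup>2) \<le> V"
    and orth: "\<And>s t. 1 \<le> s \<Longrightarrow> s < t \<Longrightarrow> expectation (\<lambda>x. U s x * U t x) = 0"
    and "0 < \<delta>"
  shows "(\<lambda>t. prob {x \<in> space M. \<delta> * real t \<le> \<bar>\<Sum>\<tau>=1..t. U \<tau> x\<bar>}) \<longlonglongrightarrow> 0"
proof (rule real_tendsto_sandwich[where f="\<lambda>_. 0" and h="\<lambda>t. V / \<delta>\<^sup>2 * (1 / real t)"])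
  note M = orthogonal_second_moment_le[OF assms(1) int V orth]
  have "prob {x \<in> space M. \<delta> * real t \<le> \<bar>\<Sum>\<tau>=1..t. U \<tau> x\<bar>} \<le> V / \<delta>\<^sup>2 * (1 / real t)"
    if "t > 0" for t
  proof -
    have "prob {x \<in> space M. \<delta> * real t \<le> \<bar>\<Sum>\<tau>=1..t. U \<tau> x\<bar>}
        \<le> expectation (\<lambda>x. (\<Sum>\<tau>=1..t. U \<tau> x)\<^sup>2) / (\<delta> * real t)\<^sup>2"
      using M(1) \<open>0 < \<delta>\<close> that by (intro second_moment_method) auto
    also have "\<dots> \<le> real t * V / (\<delta> * real t)\<^sup>2"
      using M(2) by (intro divide_right_mono) auto
    also have "\<dots> = V / \<delta>\<^sup>2 * (1 / real t)"
      using that by (simp add: power2_eq_square)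
    finally show ?thesis .
  qed
  then show "\<forall>\<^sub>F t in sequentially. prob {x \<in> space M. \<delta> * real t \<le> \<bar>\<Sum>\<tau>=1..t. U \<tau> x\<bar>} \<le> V / \<delta>\<^sup>2 * (1 / real t)"
    by (intro eventually_sequentiallyI[of 1]) auto
  show "(\<lambda>t. V / \<delta>\<^sup>2 * (1 / real t)) \<longlonglongrightarrow> 0"
    using tendsto_mult_right_zero[OF lim_1_over_n[where 'a=real]] .
qed auto

text \<open>Independence is available here between sigma-algebras; each function generates a smaller
  algebra than the one it is measurable for, which gives the product rule for expectations.\<close>

lemma indep_set_expectation_mult:
  fixes f g :: "'a \<Rightarrow> real"
  assumes ind: "indep_set (sets F) (sets G)"
    and sp: "space F = space M" "space G = space M"
    and f: "f \<in> borel_measurable F" and g: "g \<in> borel_measurable G"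
    and int: "integrable M f" "integrable M g"
  shows "expectation (\<lambda>x. f x * g x) = expectation f * expectation g"
proof (rule indep_var_lebesgue_integral)
  have "{f -` A \<inter> space M |A. A \<in> sets borel} \<subseteq> sets F"
    "{g -` A \<inter> space M |A. A \<in> sets borel} \<subseteq> sets G"
    using measurable_sets[OF f] measurable_sets[OF g] sp by auto
  then have sub: "sigma_sets (space M) {f -` A \<inter> space M |A. A \<in> sets borel} \<subseteq> sets F"
    "sigma_sets (space M) {g -` A \<inter> space M |A. A \<in> sets borel} \<subseteq> sets G"
    using sets.sigma_sets_subset[of _ F] sets.sigma_sets_subset[of _ G] sp by auto
  have "indep_set (sigma_sets (space M) {f -` A \<inter> space M |A. A \<in> sets borel})
      (sigma_sets (space M) {g -` A \<inter> space M |A. A \<in> sets borel})"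
    using ind unfolding indep_set_def
    by (rule indep_sets_mono_sets) (use sub in \<open>auto split: bool.split\<close>)
  then show "indep_var borel f borel g"
    using int by (simp add: indep_var_eq borel_measurable_integrable)
qed (fact int)+

end

section \<open>Clipping, posterior sampling and perturbed maxima\<close>

text \<open>The level is a definite description, so uniqueness is the point. At a solution some
  entry lies strictly above the floor, since otherwise the sum would be K q < 1; a smaller level
  strictly raises that entry.\<close>

lemma clip_level_eqI:
  assumes "(\<Sum>a=1..K. max (p a - \<nu>) q) = 1" and "real K * q < 1"
  shows "clip_level K q p = \<nu>"
proof -
  have less: False if "(\<Sum>a=1..K. max (p a - x) q) = 1" "(\<Sum>a=1..K. max (p a - y) q) = 1" "x < y" for x y
  proof -
    have "\<exists>a\<in>{1..K}. q < p a - y"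
    proof (rule ccontr)
      assume "\<not> ?thesis"
      then have "(\<Sum>a=1..K. max (p a - y) q) = (\<Sum>a=1..K. q)"
        by (intro sum.cong) (auto simp: max_def not_less)

      with that assms(2) show False by simp
    qed
    then obtain b where "b \<in> {1..K}" "q < p b - y" by blast
    then have "\<exists>a\<in>{1..K}. max (p a - y) q < max (p a - x) q"
      using \<open>x < y\<close> by (intro bexI[of _ b]) (auto simp: max_def)
    then have "(\<Sum>a=1..K. max (p a - y) q) < (\<Sum>a=1..K. max (p a - x) q)"
      using \<open>x < y\<close> by (intro sum_strict_mono_ex1) auto
    with that show False by simp
  qed
  show ?thesis
    unfolding clip_level_def
  proof (rule the_equality)
    show "(\<Sum>a=1..K. max (p a - \<nu>) q) = 1" by (fact assms(1))
  next
    fix x assume x: "(\<Sum>a=1..K. max (p a - x) q) = 1"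
    show "x = \<nu>"
      using less[OF x assms(1)] less[OF assms(1) x] by (cases x \<nu> rule: linorder_cases) auto
  qed
qed

text \<open>Clipping absorbs small perturbations of a point mass: the clipped vector is constant near
  each vertex of the simplex, so no continuity argument is needed for Thompson sampling.\<close>

lemma clip_near_vertex:
  assumes q: "0 < q" "real K * q < 1" and b: "b \<in> {1..K}"
    and pb: "1 - q / 2 \<le> p b" and pa: "\<And>a. a \<in> {1..K} \<Longrightarrow> a \<noteq> b \<Longrightarrow> p a \<le> q / 2"
    and a: "a \<in> {1..K}"
  shows "clip K q p a = (if a = b then 1 - (real K - 1) * q else q)"
proof -
  \<comment> \<open>The level that leaves entry \<open>b\<close> exactly the mass not taken by K - 1
    floors.\<close>
  define \<nu> where "\<nu> = p b - (1 - (real K - 1) * q)"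
  have K: "1 \<le> K" using b by auto
  have mb: "max (p b - \<nu>) q = 1 - (real K - 1) * q"
    using q by (simp add: \<nu>_def algebra_simps)
  have ma: "max (p a - \<nu>) q = q" if "a \<in> {1..K}" "a \<noteq> b" for a
  proof -
    \<comment> \<open>A second arm exists here, so \<nu> is at least (K - 1) q - q/2, hence at least
      q/2; this absorbs the tolerance q/2 on the other entries.\<close>
    have "2 \<le> K" using that b by auto
    then have "q \<le> (real K - 1) * q" using q by auto
    then have "p a - \<nu> \<le> q"
      using pa[OF that] pb q(1) unfolding \<nu>_def by linarith
    then show ?thesis by simp
  qed
  have "(\<Sum>a=1..K. max (p a - \<nu>) q) = max (p b - \<nu>) q + (\<Sum>a\<in>{1..K} - {b}. q)"
    using b ma by (subst sum.remove[of _ b]) (auto intro!: sum.cong)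
  also have "\<dots> = 1"
    unfolding mb using b K by (simp add: of_nat_diff)
  finally have "clip_level K q p = \<nu>"
    using q by (intro clip_level_eqI) auto
  then show ?thesis
    using mb ma a by (auto simp: clip_def)
qed

text \<open>Chebyshev with variance \<open>v\<close>; this crude tail is enough because the
  posterior variances shrink to 0.\<close>

lemma normal_tail:
  assumes v: "0 < v" and \<delta>: "0 < \<delta>"
  shows "measure (density lborel (normal_density m (sqrt v))) {y. \<delta> \<le> \<bar>y - m\<bar>} \<le> v / \<delta>\<^sup>2"
proof -
  let ?N = "density lborel (normal_density m (sqrt v))"
  interpret prob_space ?N using v by (intro prob_space_normal_density) simp
  have hb: "has_bochner_integral lborel (\<lambda>x. normal_density m (sqrt v) x * (x - m)\<^sup>2) v"
    using normal_moment_even[of "sqrt v" m 1] v by (simp add: fact_numeral)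
  have "integrable ?N (\<lambda>y. (y - m)\<^sup>2)" "expectation (\<lambda>y. (y - m)\<^sup>2) = v"
    using hb v by (auto simp: integrable_density integral_density has_bochner_integral_iff)
  then show ?thesis
    using second_moment_method[of "\<lambda>y. y - m" \<delta>] \<delta> by simp
qed

text \<open>If every coordinate stays within \<delta> of its mean, the separation 2 \<delta> makes
  coordinate \<open>b\<close> the strict maximum. A union bound over the marginals controls the
  complement of this win of \<open>b\<close>, and that complement contains the win of any other arm,
  so one bound serves both claims.\<close>

lemma ts_vertex_bound:
  fixes K :: nat and m v :: "nat \<Rightarrow> real"
  defines "P \<equiv> normal_diag K m v"
  assumes v: "\<And>i. i \<in> {1..K} \<Longrightarrow> 0 < v i \<and> v i \<le> w" and \<delta>: "0 < \<delta>" and b: "b \<in> {1..K}"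
    and sep: "\<And>i. i \<in> {1..K} \<Longrightarrow> i \<noteq> b \<Longrightarrow> m i + 2 * \<delta> \<le> m b"
  shows "1 - real K * (w / \<delta>\<^sup>2) \<le> measure P {x \<in> space P. \<forall>i\<in>{1..K} - {b}. x i < x b}"
    and "a \<in> {1..K} \<Longrightarrow> a \<noteq> b \<Longrightarrow>
      measure P {x \<in> space P. \<forall>i\<in>{1..K} - {a}. x i < x a} \<le> real K * (w / \<delta>\<^sup>2)"
proof -
  let ?N = "\<lambda>i. density lborel (normal_density (m i) (sqrt (v i)))"
  let ?B = "\<lambda>a. {x \<in> space P. \<forall>i\<in>{1..K} - {a}. x i < x a}"
  let ?T = "\<lambda>i. {x \<in> space P. \<delta> \<le> \<bar>x i - m i\<bar>}"
  have P: "P = PiM {1..K} ?N" by (simp add: P_def normal_diag_def)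
  have pN: "prob_space (?N i)" if "i \<in> {1..K}" for i
    using v[OF that] by (intro prob_space_normal_density) simp
  have "prob_space P" unfolding P by (intro prob_space_PiM pN)
  then interpret P: prob_space P .
  have [measurable]: "(\<lambda>x. x i) \<in> borel_measurable P" if "i \<in> {1..K}" for i
    using measurable_component_singleton[OF that, of ?N] unfolding P by simp
  have [measurable]: "?B a \<in> sets P" if "a \<in> {1..K}" for a
    using that by measurable
  have [measurable]: "?T i \<in> sets P" if "i \<in> {1..K}" for i
    using that by measurable
  have T: "measure P (?T i) \<le> w / \<delta>\<^sup>2" if i: "i \<in> {1..K}" for i
  proof -
    have "measure P (?T i) = measure (distr P (?N i) (\<lambda>x. x i)) {y. \<delta> \<le> \<bar>y - m i\<bar>}"
      using i by (subst measure_distr) (auto intro!: arg_cong[where f="measure P"])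
    also have "distr P (?N i) (\<lambda>x. x i) = ?N i"
      unfolding P by (rule distr_PiM_component[OF pN i])
    also have "measure (?N i) {y. \<delta> \<le> \<bar>y - m i\<bar>} \<le> v i / \<delta>\<^sup>2"
      using v[OF i] \<delta> by (intro normal_tail) auto
    also have "\<dots> \<le> w / \<delta>\<^sup>2"
      using v[OF i] by (intro divide_right_mono) auto
    finally show ?thesis .
  qed
  have "space P - ?B b \<subseteq> (\<Union>i\<in>{1..K}. ?T i)"
  proof
    fix x assume x: "x \<in> space P - ?B b"
    then obtain i where i: "i \<in> {1..K}" "i \<noteq> b" "x b \<le> x i" by (force simp: not_less)
    with sep[of i] have "\<delta> \<le> \<bar>x i - m i\<bar> \<or> \<delta> \<le> \<bar>x b - m b\<bar>" by linarith
    with i b x show "x \<in> (\<Union>i\<in>{1..K}. ?T i)" by auto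
  qed
  then have "measure P (space P - ?B b) \<le> measure P (\<Union>i\<in>{1..K}. ?T i)"
    by (intro P.finite_measure_mono) auto
  also have "\<dots> \<le> (\<Sum>i=1..K. measure P (?T i))"
    by (intro P.finite_measure_subadditive_finite) auto
  also have "\<dots> \<le> (\<Sum>i=1..K. w / \<delta>\<^sup>2)"
    by (intro sum_mono T) auto
  finally have c: "measure P (space P - ?B b) \<le> real K * (w / \<delta>\<^sup>2)" by simp
  then show "1 - real K * (w / \<delta>\<^sup>2) \<le> measure P (?B b)"
    using P.prob_compl[of "?B b"] b by simp
  show "measure P (?B a) \<le> real K * (w / \<delta>\<^sup>2)" if "a \<in> {1..K}" "a \<noteq> b"
  proof -
    have "?B a \<subseteq> space P - ?B b"
    proof
      fix x assume x: "x \<in> ?B a"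
      then have "x b < x a" using that b by auto
      then have "\<not> x a < x b" by simp
      with x that show "x \<in> space P - ?B b" by blast
    qed
    then have "measure P (?B a) \<le> measure P (space P - ?B b)"
      using b by (intro P.finite_measure_mono) auto
    with c show ?thesis by simp
  qed
qed

text \<open>Two errors of \<Delta>/4 consume only half of the gap.\<close>

lemma arg_max_perturbed:
  fixes f \<mu> :: "nat \<Rightarrow> real"
  assumes g: "is_arg_max f (\<lambda>i. i \<in> I) g" and b: "b \<in> I"
    and close: "\<And>i. i \<in> I \<Longrightarrow> \<bar>f i - \<mu> i\<bar> \<le> \<Delta> / 4"
    and gap: "\<And>i. i \<in> I \<Longrightarrow> i \<noteq> b \<Longrightarrow> \<mu> i + \<Delta> \<le> \<mu> b" and \<Delta>: "0 < \<Delta>"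
  shows "g = b"
proof (rule ccontr)
  assume "g \<noteq> b"
  with g have "g \<in> I" "\<not> f g < f b" using b by (auto simp: is_arg_max_def)
  with gap[OF _ \<open>g \<noteq> b\<close>] close[of g] close[OF b] \<Delta> show False by fastforce
qed

text \<open>The decision in round \<open>t\<close> rests on t - 1 observations, hence the shifted
  denominator.\<close>

lemma tendsto_const_over_linear:
  fixes k r :: real
  assumes "0 < r"
  shows "(\<lambda>t. k / (r * real (t - 1))) \<longlonglongrightarrow> 0"
proof (rule LIMSEQ_imp_Suc)
  show "(\<lambda>t. k / (r * real (Suc t - 1))) \<longlonglongrightarrow> 0"
    using tendsto_mult_right_zero[OF lim_1_over_n[where 'a=real], of "k / r"] by simp
qed

section \<open>The bandit process\<close>

context contextual_bandit
begin

abbreviation "Hist n \<equiv> hist_alg M K X \<pi> A Y n"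
abbreviation "HistCtx t \<equiv> hist_ctx_alg M K X \<pi> A Y t"
abbreviation "Pot t \<equiv> vimage_algebra (space M) (potentials K Y t) (potential_space K)"

section \<open>Measurability of the observed data and of the history\<close>

lemma action_in: "t \<ge> 1 \<Longrightarrow> \<omega> \<in> space M \<Longrightarrow> A t \<omega> \<in> {1..K}"
  using measurable_space[OF A_measurable] by force

lemma action_eq_measurable: "t \<ge> 1 \<Longrightarrow> {\<omega> \<in> space M. A t \<omega> = a} \<in> events"
proof -
  assume t: "t \<ge> 1"
  have "A t -` ({a} \<inter> {1..K}) \<inter> space M \<in> events"
    using A_measurable[OF t] by (rule measurable_sets) auto
  also have "A t -` ({a} \<inter> {1..K}) \<inter> space M = {\<omega> \<in> space M. A t \<omega> = a}"
    using action_in[OF t] by auto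
  finally show ?thesis .
qed

lemma action_indicator_measurable [measurable]:
  "t \<ge> 1 \<Longrightarrow> (\<lambda>\<omega>. of_bool (A t \<omega> = a) :: real) \<in> borel_measurable M"
  using action_eq_measurable by simp

text \<open>The outcome is read off at a random index; a finite sum over the arms reduces its
  measurability to that of each \<open>Y t a\<close>.\<close>

lemma obs_outcome_eq:
  "t \<ge> 1 \<Longrightarrow> \<omega> \<in> space M \<Longrightarrow> obs_outcome Y A t \<omega> = (\<Sum>a=1..K. of_bool (A t \<omega> = a) * Y t a \<omega>)"
proof -
  assume "t \<ge> 1" "\<omega> \<in> space M"
  then have "A t \<omega> \<in> {1..K}" by (rule action_in)
  moreover have "(\<Sum>a=1..K. of_bool (A t \<omega> = a) * Y t a \<omega>) = (\<Sum>a=1..K. if A t \<omega> = a then Y t a \<omega> else 0)"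
    by (intro sum.cong) auto
  ultimately show ?thesis by (simp add: obs_outcome_def)
qed

lemma obs_outcome_measurable: "t \<ge> 1 \<Longrightarrow> obs_outcome Y A t \<in> borel_measurable M"
proof -
  assume t: "t \<ge> 1"
  have "(\<lambda>\<omega>. \<Sum>a=1..K. of_bool (A t \<omega> = a) * Y t a \<omega>) \<in> borel_measurable M"
    using t by (intro borel_measurable_sum borel_measurable_times Y_measurable
        action_indicator_measurable)
  then show ?thesis
    by (rule measurable_cong[THEN iffD2, rotated]) (use t in \<open>rule obs_outcome_eq\<close>)
qed

lemma potentials_measurable: "t \<ge> 1 \<Longrightarrow> potentials K Y t \<in> measurable M (potential_space K)"
  unfolding potentials_def potential_space_def by (intro measurable_restrict Y_measurable)

lemma history_measurable_if:
  assumes "\<And>\<tau> a. \<tau> \<in> {1..n} \<Longrightarrow> a \<in> {1..K} \<Longrightarrow> (\<lambda>\<omega>. \<pi> \<tau> \<omega> a) \<in> borel_measurable M"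
  shows "history K X \<pi> A Y n \<in> measurable M (history_space K n)"
  unfolding history_def history_space_def
  by (intro measurable_restrict measurable_Pair X_measurable A_measurable obs_outcome_measurable assms)
    auto

text \<open>The policy of a round is measurable in an algebra generated by a history that itself
  records the earlier policies. Strong induction over rounds breaks the circle;
  \<open>history_measurable_if\<close> takes the earlier rounds as a hypothesis for this
  purpose.\<close>

lemma policy_measurable: "t \<ge> 1 \<Longrightarrow> a \<in> {1..K} \<Longrightarrow> (\<lambda>\<omega>. \<pi> t \<omega> a) \<in> borel_measurable M"
proof (induction t arbitrary: a rule: less_induct)
  case (less t)
  have "history K X \<pi> A Y (t - 1) \<in> measurable M (history_space K (t - 1))"
    by (rule history_measurable_if) (use less in auto)
  then have "(\<lambda>\<omega>. (history K X \<pi> A Y (t - 1) \<omega>, X t \<omega>)) \<in> measurable M (history_space K (t - 1) \<Otimes>\<^sub>M borel)"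
    using X_measurable less.prems by (intro measurable_Pair) auto
  \<comment> \<open>Measurability of \<open>id\<close> encodes inclusion of sigma-algebras; the same
    device recurs below.\<close>
  then have "id \<in> measurable M (HistCtx t)"
    unfolding hist_ctx_alg_def by (intro measurable_vimage_algebra2) auto
  from measurable_comp[OF this policy_adapted[OF less.prems]] show ?case
    by (simp add: comp_def)
qed

lemma history_measurable: "history K X \<pi> A Y n \<in> measurable M (history_space K n)"
  by (rule history_measurable_if) (use policy_measurable in auto)

lemma space_alg [simp]: "space (Hist n) = space M" "space (HistCtx t) = space M"
  by (simp_all add: hist_alg_def hist_ctx_alg_def)

lemma history_measurable_Hist: "history K X \<pi> A Y n \<in> measurable (Hist n) (history_space K n)"
  unfolding hist_alg_def
  by (rule measurable_vimage_algebra1) (use measurable_space[OF history_measurable] in auto)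

lemma subalgebra_HistCtx: "t \<ge> 1 \<Longrightarrow> subalgebra M (HistCtx t)"
  using history_measurable[of "t - 1"] X_measurable[of t]
  by (auto simp: subalgebra_def hist_ctx_alg_def sets_vimage_algebra intro!: sets.sigma_sets_subset)

lemma Hist_subset_HistCtx: "t \<ge> 1 \<Longrightarrow> sets (Hist (t - 1)) \<subseteq> sets (HistCtx t)"
proof -
  assume t: "t \<ge> 1"
  have "(\<lambda>\<omega>. (history K X \<pi> A Y (t - 1) \<omega>, X t \<omega>)) \<in> measurable (HistCtx t) (history_space K (t - 1) \<Otimes>\<^sub>M borel)"
    unfolding hist_ctx_alg_def
    by (rule measurable_vimage_algebra1)
      (use measurable_space[OF history_measurable] in \<open>auto simp: space_pair_measure\<close>)
  then have "(\<lambda>\<omega>. fst (history K X \<pi> A Y (t - 1) \<omega>, X t \<omega>)) \<in> measurable (HistCtx t) (history_space K (t - 1))"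
    by (rule measurable_compose[OF _ measurable_fst])
  then have "id \<in> measurable (HistCtx t) (Hist (t - 1))"
    unfolding hist_alg_def by (intro measurable_vimage_algebra2) auto
  from measurable_sets[OF this] show ?thesis
    using sets.sets_into_space[of _ "Hist (t - 1)"] by (auto simp: Int_absorb2)
qed

lemma measurable_Hist_HistCtx:
  "t \<ge> 1 \<Longrightarrow> f \<in> borel_measurable (Hist (t - 1)) \<Longrightarrow> f \<in> borel_measurable (HistCtx t)"
  using Hist_subset_HistCtx unfolding measurable_def by auto

lemma measurable_Hist_imp: "t \<ge> 1 \<Longrightarrow> f \<in> borel_measurable (Hist (t - 1)) \<Longrightarrow> f \<in> borel_measurable M"
  by (rule measurable_from_subalg[OF subalgebra_HistCtx measurable_Hist_HistCtx])

lemma sigma_finite_HistCtx: "t \<ge> 1 \<Longrightarrow> sigma_finite_subalgebra M (HistCtx t)"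
  by (intro finite_measure_subalgebra_is_sigma_finite)
    (auto simp: finite_measure_subalgebra_def finite_measure_subalgebra_axioms_def
      subalgebra_HistCtx intro: finite_measure_axioms)

text \<open>Past rounds are coordinates of the history, so earlier noise terms and policy values
  count as known when later rounds are conditioned on it.\<close>

lemma history_components_measurable:
  assumes "1 \<le> s" "s \<le> n"
  shows "(\<lambda>\<omega>. of_bool (A s \<omega> = a) :: real) \<in> borel_measurable (Hist n)"
    and "obs_outcome Y A s \<in> borel_measurable (Hist n)"
    and "a \<in> {1..K} \<Longrightarrow> (\<lambda>\<omega>. \<pi> s \<omega> a) \<in> borel_measurable (Hist n)"
proof -
  have s: "s \<in> {1..n}" using assms by simp
  have "(\<lambda>\<omega>. history K X \<pi> A Y n \<omega> s) \<in> measurable (Hist n)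
      (borel \<Otimes>\<^sub>M (PiM {1..K} (\<lambda>_. borel) \<Otimes>\<^sub>M (count_space {1..K} \<Otimes>\<^sub>M borel)))"
    by (rule measurable_compose[OF history_measurable_Hist])
      (unfold history_space_def, rule measurable_component_singleton[OF s])
  also have "(\<lambda>\<omega>. history K X \<pi> A Y n \<omega> s) = (\<lambda>\<omega>. (X s \<omega>, (\<lambda>a\<in>{1..K}. \<pi> s \<omega> a), A s \<omega>, obs_outcome Y A s \<omega>))"
    using s by (simp add: history_def)
  finally have h: "(\<lambda>\<omega>. (X s \<omega>, (\<lambda>a\<in>{1..K}. \<pi> s \<omega> a), A s \<omega>, obs_outcome Y A s \<omega>)) \<in> measurable (Hist n)
      (borel \<Otimes>\<^sub>M (PiM {1..K} (\<lambda>_. borel) \<Otimes>\<^sub>M (count_space {1..K} \<Otimes>\<^sub>M borel)))" .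
  note h2 = measurable_compose[OF measurable_compose[OF h measurable_snd] measurable_snd]
  have A: "A s \<in> measurable (Hist n) (count_space {1..K})"
    using measurable_compose[OF h2 measurable_fst] by simp
  show "(\<lambda>\<omega>. of_bool (A s \<omega> = a) :: real) \<in> borel_measurable (Hist n)"
    by (rule measurable_compose[OF A]) simp
  show "obs_outcome Y A s \<in> borel_measurable (Hist n)"
    using measurable_compose[OF h2 measurable_snd] by simp
  assume a: "a \<in> {1..K}"
  have "(\<lambda>\<omega>. \<lambda>a\<in>{1..K}. \<pi> s \<omega> a) \<in> measurable (Hist n) (PiM {1..K} (\<lambda>_. borel))"
    using measurable_compose[OF measurable_compose[OF h measurable_snd] measurable_fst] by simp
  from measurable_compose[OF this measurable_component_singleton[OF a]] a
  show "(\<lambda>\<omega>. \<pi> s \<omega> a) \<in> borel_measurable (Hist n)" by simp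
qed

section \<open>Identical laws, and independence of the current outcomes from the past\<close>

lemma Y_ident:
  assumes t: "t \<ge> 1" and a: "a \<in> {1..K}"
  shows "distr M borel (Y t a) = distr M borel (Y 1 a)"
proof -
  let ?T = "\<lambda>t \<omega>. (X t \<omega>, potentials K Y t \<omega>)"
  have T: "?T t \<in> measurable M (borel \<Otimes>\<^sub>M potential_space K)" if "t \<ge> 1" for t
    using X_measurable potentials_measurable that by (intro measurable_Pair) auto
  have p: "(\<lambda>p. snd p a) \<in> borel_measurable (borel \<Otimes>\<^sub>M potential_space K)"
    unfolding potential_space_def
    by (rule measurable_compose[OF measurable_snd measurable_component_singleton[OF a]])
  have "distr M borel (Y t a) = distr (distr M (borel \<Otimes>\<^sub>M potential_space K) (?T t)) borel (\<lambda>p. snd p a)" if "t \<ge> 1" for t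
    using a by (simp add: distr_distr[OF p T[OF that]] comp_def) (simp add: potentials_def)
  then show ?thesis
    using t tuples_ident[OF t] by simp
qed

lemma expectation_Y_ident:
  fixes f :: "real \<Rightarrow> real"
  assumes t: "t \<ge> 1" and a: "a \<in> {1..K}" and [measurable]: "f \<in> borel_measurable borel"
  shows "expectation (\<lambda>\<omega>. f (Y t a \<omega>)) = expectation (\<lambda>\<omega>. f (Y 1 a \<omega>))"
    and "integrable M (\<lambda>\<omega>. f (Y t a \<omega>)) \<longleftrightarrow> integrable M (\<lambda>\<omega>. f (Y 1 a \<omega>))"
  using Y_ident[OF t a] Y_measurable[OF t a] Y_measurable[of 1 a] a
  by (simp_all flip: integral_distr[of _ M borel f] integrable_distr_eq[of _ M borel f])

text \<open>The potential outcomes are a projection of the full tuple; forgetting the context only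
  shrinks the algebra.\<close>

lemma Pot_indep_Hist:
  assumes t: "t \<ge> 1"
  shows "indep_set (sets (Hist (t - 1))) (sets (Pot t))"
proof -
  let ?T = "\<lambda>\<omega>. (X t \<omega>, potentials K Y t \<omega>)"
  let ?V = "vimage_algebra (space M) ?T (borel \<Otimes>\<^sub>M potential_space K)"
  have "?T \<in> measurable ?V (borel \<Otimes>\<^sub>M potential_space K)"
    by (rule measurable_vimage_algebra1)
      (use measurable_space[OF potentials_measurable[OF t]] in \<open>auto simp: space_pair_measure\<close>)
  then have "potentials K Y t \<in> measurable ?V (potential_space K)"
    using measurable_compose[OF _ measurable_snd] by fastforce
  then have "id \<in> measurable ?V (Pot t)"
    by (intro measurable_vimage_algebra2) auto
  from measurable_sets[OF this] have sub: "sets (Pot t) \<subseteq> sets ?V"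
    using sets.sets_into_space[of _ "Pot t"] by (auto simp: Int_absorb2)
  have "indep_set (sets ?V) (sets (Hist (t - 1)))"
    by (rule tuple_indep_history[OF t])
  then have "indep_set (sets (Pot t)) (sets (Hist (t - 1)))"
    unfolding indep_set_def
    by (rule indep_sets_mono_sets) (use sub in \<open>auto split: bool.split\<close>)
  note ind = this
  show ?thesis
  proof (rule indep_setI[OF indep_setD_ev2[OF ind] indep_setD_ev1[OF ind]])
    fix C D assume "C \<in> sets (Hist (t - 1))" "D \<in> sets (Pot t)"
    then show "prob (C \<inter> D) = prob C * prob D"
      using indep_setD[OF ind, of D C] by (simp add: Int_commute mult.commute)
  qed
qed

lemma Y_measurable_Pot:
  assumes t: "t \<ge> 1" and a: "a \<in> {1..K}"
  shows "Y t a \<in> borel_measurable (Pot t)"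
proof -
  have "potentials K Y t \<in> measurable (Pot t) (potential_space K)"
    by (rule measurable_vimage_algebra1) (use measurable_space[OF potentials_measurable[OF t]] in auto)
  then have "(\<lambda>\<omega>. potentials K Y t \<omega> a) \<in> borel_measurable (Pot t)"
    unfolding potential_space_def by (rule measurable_compose[OF _ measurable_component_singleton[OF a]])
  then show ?thesis using a by (simp add: potentials_def)
qed

section \<open>Conditioning on the history and the context\<close>

lemma policy_bounds: "t \<ge> 1 \<Longrightarrow> \<omega> \<in> space M \<Longrightarrow> a \<in> {1..K} \<Longrightarrow> 0 \<le> \<pi> t \<omega> a \<and> \<pi> t \<omega> a \<le> 1"
  using policy_simplex[of t \<omega>] member_le_sum[of a "{1..K}" "\<pi> t \<omega>"] by (auto simp: prob_simplex_def)

text \<open>The conditional expectation in \<open>action_drawn\<close>, tested against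
  \<open>g\<close>. It centres the play counts, and it also trades policy values back for actions in
  the independence proof below.\<close>

lemma integral_action_policy:
  assumes t: "t \<ge> 1" and a: "a \<in> {1..K}" and g: "g \<in> borel_measurable (HistCtx t)"
    and int: "integrable M (\<lambda>\<omega>. g \<omega> * of_bool (A t \<omega> = a))"
  shows "expectation (\<lambda>\<omega>. g \<omega> * of_bool (A t \<omega> = a)) = expectation (\<lambda>\<omega>. g \<omega> * \<pi> t \<omega> a)"
proof -
  interpret S: sigma_finite_subalgebra M "HistCtx t" by (rule sigma_finite_HistCtx[OF t])
  let ?B = "{\<omega> \<in> space M. A t \<omega> = a}"
  have "expectation (\<lambda>\<omega>. g \<omega> * of_bool (A t \<omega> = a)) = expectation (\<lambda>\<omega>. g \<omega> * indicator ?B \<omega>)"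
    by (intro Bochner_Integration.integral_cong) auto
  also have "\<dots> = expectation (\<lambda>\<omega>. g \<omega> * real_cond_exp M (HistCtx t) (indicator ?B) \<omega>)"
  proof (rule S.real_cond_exp_intg(2)[symmetric])
    show "integrable M (\<lambda>\<omega>. g \<omega> * indicator ?B \<omega>)"
      using int by (rule Bochner_Integration.integrable_cong[THEN iffD1, rotated -1]) auto
  qed (use g action_eq_measurable[OF t] in auto)
  also have "\<dots> = expectation (\<lambda>\<omega>. g \<omega> * \<pi> t \<omega> a)"
  proof (rule integral_cong_AE)
    show "AE \<omega> in M. g \<omega> * real_cond_exp M (HistCtx t) (indicator ?B) \<omega> = g \<omega> * \<pi> t \<omega> a"
      using action_drawn[OF t a] by eventually_elim simp
  qed (use measurable_from_subalg[OF subalgebra_HistCtx[OF t] g] policy_measurable[OF t a] in auto)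
  finally show ?thesis .
qed

text \<open>For \<open>C\<close> in the history and \<open>D\<close> in the potentials, conditioning
  on history and context turns the probability of \<open>C \<inter> B \<inter> D\<close> into the
  mean of 1_C times \<pi> times P(D | history, context), by unconfoundedness. Removing the
  conditioning and using independence of \<open>D\<close> from the history pulls out P(D); what
  remains is the probability of \<open>C \<inter> B\<close>.\<close>

lemma action_Hist_indep_Pot:
  assumes t: "t \<ge> 1" and a: "a \<in> {1..K}"
    and unconf: "unconfounded M K X Y A \<pi>"
    and hb: "(\<lambda>\<omega>. \<pi> t \<omega> a) \<in> borel_measurable (Hist (t - 1))"
  defines "B \<equiv> {\<omega> \<in> space M. A t \<omega> = a}"
  shows "indep_set (sigma_sets (space M) {C \<inter> B |C. C \<in> sets (Hist (t - 1))}) (sets (Pot t))"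
proof -
  interpret S: sigma_finite_subalgebra M "HistCtx t" by (rule sigma_finite_HistCtx[OF t])
  have B: "B \<in> events" unfolding B_def by (rule action_eq_measurable[OF t])
  have B': "B \<in> sets (vimage_algebra (space M) (A t) (count_space {1..K}))"
  proof -
    have "A t -` {a} \<inter> space M = B" by (auto simp: B_def)
    then show ?thesis using in_vimage_algebra[of "{a}" "count_space {1..K}" "A t" "space M"] a by simp
  qed
  note PH = Pot_indep_Hist[OF t]
  have prod: "prob (C \<inter> B \<inter> D) = prob (C \<inter> B) * prob D"
    if C: "C \<in> sets (Hist (t - 1))" and D: "D \<in> sets (Pot t)" for C D
  proof -
    have CM: "C \<in> events" and DM: "D \<in> events"
      using C D indep_setD_ev1[OF PH] indep_setD_ev2[OF PH] by auto
    have CF: "indicat_real C \<in> borel_measurable (HistCtx t)"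
      using C by (intro measurable_Hist_HistCtx[OF t]) simp
    have \<pi>M: "(\<lambda>\<omega>. \<pi> t \<omega> a) \<in> borel_measurable M" by (rule policy_measurable[OF t a])
    have C\<pi>F: "(\<lambda>\<omega>. indicat_real C \<omega> * \<pi> t \<omega> a) \<in> borel_measurable (HistCtx t)"
      using CF policy_adapted[OF t a] by simp
    have C\<pi>H: "(\<lambda>\<omega>. indicat_real C \<omega> * \<pi> t \<omega> a) \<in> borel_measurable (Hist (t - 1))"
      using C hb by simp
    have C\<pi>D: "integrable M (\<lambda>\<omega>. (indicat_real C \<omega> * \<pi> t \<omega> a) * indicat_real D' \<omega>)" if "D' \<in> events" for D'
      using policy_bounds[OF t _ a] CM that \<pi>M
      by (intro integrable_const_bound[where B=1]) (auto simp: indicator_def)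
    have C\<pi>: "integrable M (\<lambda>\<omega>. indicat_real C \<omega> * \<pi> t \<omega> a)"
      using policy_bounds[OF t _ a] CM \<pi>M
      by (intro integrable_const_bound[where B=1]) (auto simp: indicator_def)
    have CBD: "integrable M (\<lambda>\<omega>. indicat_real C \<omega> * indicat_real (B \<inter> D) \<omega>)"
      using CM B DM by (intro integrable_const_bound[where B=1]) (auto simp: indicator_def)
    have "prob (C \<inter> B \<inter> D) = expectation (\<lambda>\<omega>. indicat_real C \<omega> * indicat_real (B \<inter> D) \<omega>)"
      using CM B DM by (simp add: Int_assoc flip: indicator_inter_arith)
    also have "\<dots> = expectation (\<lambda>\<omega>. indicat_real C \<omega> * real_cond_exp M (HistCtx t) (indicat_real (B \<inter> D)) \<omega>)"
      by (rule S.real_cond_exp_intg(2)[symmetric]) (use CBD CF B DM in auto)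
    also have "\<dots> = expectation (\<lambda>\<omega>. (indicat_real C \<omega> * \<pi> t \<omega> a) * real_cond_exp M (HistCtx t) (indicat_real D) \<omega>)"
    proof (rule integral_cong_AE)
      have "AE \<omega> in M. real_cond_exp M (HistCtx t) (indicat_real (B \<inter> D)) \<omega>
          = real_cond_exp M (HistCtx t) (indicat_real B) \<omega> * real_cond_exp M (HistCtx t) (indicat_real D) \<omega>"
        using unconf t B' D unfolding unconfounded_def cond_indep_alg_def by blast
      with action_drawn[OF t a, folded B_def]
      show "AE \<omega> in M. indicat_real C \<omega> * real_cond_exp M (HistCtx t) (indicat_real (B \<inter> D)) \<omega>
          = (indicat_real C \<omega> * \<pi> t \<omega> a) * real_cond_exp M (HistCtx t) (indicat_real D) \<omega>"
        by eventually_elim simp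
    qed (use CM \<pi>M in auto)
    also have "\<dots> = expectation (\<lambda>\<omega>. (indicat_real C \<omega> * \<pi> t \<omega> a) * indicat_real D \<omega>)"
      by (rule S.real_cond_exp_intg(2)) (use C\<pi>D C\<pi>F DM in auto)
    \<comment> \<open>Here \<open>hb\<close> enters: the weight is a function of the history alone.
      A weight that sees the context could be correlated with \<open>D\<close> through
      \<open>X t\<close>.\<close>
    also have "\<dots> = expectation (\<lambda>\<omega>. indicat_real C \<omega> * \<pi> t \<omega> a) * expectation (indicat_real D)"
      by (rule indep_set_expectation_mult[OF PH _ _ C\<pi>H]) (use C\<pi> D DM in \<open>auto simp: emeasure_eq_measure\<close>)
    also have "expectation (\<lambda>\<omega>. indicat_real C \<omega> * \<pi> t \<omega> a) = expectation (\<lambda>\<omega>. indicat_real C \<omega> * of_bool (A t \<omega> = a))"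
      by (rule integral_action_policy[symmetric, OF t a CF], rule integrable_const_bound[where B=1])
        (use CM t in \<open>auto simp: indicator_def\<close>)
    also have "\<dots> = expectation (indicat_real (C \<inter> B))"
      by (intro Bochner_Integration.integral_cong) (auto simp: B_def indicator_def)
    finally show ?thesis using CM B DM by simp
  qed
  have "indep_set {C \<inter> B |C. C \<in> sets (Hist (t - 1))} (sets (Pot t))"
  proof (rule indep_setI)
    show "{C \<inter> B |C. C \<in> sets (Hist (t - 1))} \<subseteq> events"
      using B indep_setD_ev1[OF PH] by auto
  qed (use prod indep_setD_ev2[OF PH] in auto)
  \<comment> \<open>With \<open>B\<close> fixed, the sets \<open>C \<inter> B\<close> form a
    pi-system, which extends the product rule to the algebra they generate.\<close>
  moreover have "Int_stable {C \<inter> B |C. C \<in> sets (Hist (t - 1))}"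
  proof (rule Int_stableI)
    fix U V assume "U \<in> {C \<inter> B |C. C \<in> sets (Hist (t - 1))}" "V \<in> {C \<inter> B |C. C \<in> sets (Hist (t - 1))}"
    then obtain C D where "C \<in> sets (Hist (t - 1))" "D \<in> sets (Hist (t - 1))" "U = C \<inter> B" "V = D \<inter> B"
      by blast
    then have "U \<inter> V = (C \<inter> D) \<inter> B" "C \<inter> D \<in> sets (Hist (t - 1))" by auto
    then show "U \<inter> V \<in> {C \<inter> B |C. C \<in> sets (Hist (t - 1))}" by blast
  qed
  ultimately have "indep_set (sigma_sets (space M) {C \<inter> B |C. C \<in> sets (Hist (t - 1))})
      (sigma_sets (space M) (sets (Pot t)))"
    by (rule indep_set_sigma_sets) (rule sets.Int_stable)
  then show ?thesis
    using sets.sigma_sets_eq[of "Pot t"] by simp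
qed

text \<open>Multiplied by the indicator of the action, \<open>g\<close> vanishes off
  \<open>B\<close> and so becomes measurable in the algebra generated by the sets
  \<open>C \<inter> B\<close>, which \<open>g\<close> alone need not be.\<close>

lemma expectation_Hist_action_Pot:
  fixes g h :: "'w \<Rightarrow> real"
  assumes t: "t \<ge> 1" and a: "a \<in> {1..K}"
    and unconf: "unconfounded M K X Y A \<pi>"
    and hb: "(\<lambda>\<omega>. \<pi> t \<omega> a) \<in> borel_measurable (Hist (t - 1))"
    and g: "g \<in> borel_measurable (Hist (t - 1))" and intg: "integrable M g"
    and h: "h \<in> borel_measurable (Pot t)" and inth: "integrable M h"
  shows "expectation (\<lambda>\<omega>. g \<omega> * of_bool (A t \<omega> = a) * h \<omega>)
    = expectation (\<lambda>\<omega>. g \<omega> * of_bool (A t \<omega> = a)) * expectation h"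
proof -
  define B where "B = {\<omega> \<in> space M. A t \<omega> = a}"
  define E where "E = {C \<inter> B |C. C \<in> sets (Hist (t - 1))}"
  have E: "E \<subseteq> Pow (space M)" by (auto simp: E_def B_def)
  let ?G = "sigma (space M) E" and ?f = "\<lambda>\<omega>. g \<omega> * of_bool (A t \<omega> = a) :: real"
  have sG: "space ?G = space M" using E by simp
  have setsG: "sets ?G = sigma_sets (space M) E" using E by simp
  have f: "?f \<in> borel_measurable ?G"
  proof (rule measurableI)
    fix S :: "real set" assume S: "S \<in> sets borel"
    have *: "g -` S' \<inter> B \<in> sets ?G" if "S' \<in> sets borel" for S'
    proof -
      have "g -` S' \<inter> space M \<in> sets (Hist (t - 1))"
        using measurable_sets[OF g that] by simp
      moreover have "g -` S' \<inter> B = (g -` S' \<inter> space M) \<inter> B" by (auto simp: B_def)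
      ultimately have "g -` S' \<inter> B \<in> E" unfolding E_def by blast
      then show ?thesis unfolding setsG by (rule sigma_sets.Basic)
    qed
    show "?f -` S \<inter> space ?G \<in> sets ?G"
    \<comment> \<open>Off \<open>B\<close> the product is 0. A target set containing 0 is therefore
      handled through its complement, whose preimage lies inside \<open>B\<close>.\<close>
    proof (cases "0 \<in> S")
      case True
      have pw: "?f \<omega> \<in> S \<longleftrightarrow> \<not> (g \<omega> \<in> - S \<and> A t \<omega> = a)" for \<omega>
        using True by (cases "A t \<omega> = a") auto
      have "?f -` S \<inter> space ?G = space ?G - g -` (- S) \<inter> B"
        unfolding sG B_def set_eq_iff vimage_eq Int_iff Diff_iff mem_Collect_eq pw by blast
      also have "\<dots> \<in> sets ?G" using *[of "- S"] S by (intro sets.compl_sets) auto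
      finally show ?thesis .
    next
      case False
      have pw: "?f \<omega> \<in> S \<longleftrightarrow> g \<omega> \<in> S \<and> A t \<omega> = a" for \<omega>
        using False by (cases "A t \<omega> = a") auto
      have "?f -` S \<inter> space ?G = g -` S \<inter> B"
        unfolding sG B_def set_eq_iff vimage_eq Int_iff Diff_iff mem_Collect_eq pw by blast
      then show ?thesis using *[OF S] by simp
    qed
  qed simp
  have "?f \<in> borel_measurable M"
    using measurable_Hist_imp[OF t g] action_indicator_measurable[OF t] by simp
  then have intf: "integrable M ?f"
    by (rule Bochner_Integration.integrable_bound[OF intg]) (auto simp: abs_mult intro!: mult_left_le)
  have "indep_set (sets ?G) (sets (Pot t))"
    unfolding setsG unfolding E_def B_def by (rule action_Hist_indep_Pot[OF t a unconf hb])
  from indep_set_expectation_mult[OF this sG space_vimage_algebra f h intf inth]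
  show ?thesis .
qed

section \<open>Weak laws for the centred rewards and the play counts\<close>

abbreviation noise :: "nat \<Rightarrow> nat \<Rightarrow> 'w \<Rightarrow> real" where
  "noise a t \<omega> \<equiv> of_bool (A t \<omega> = a) * (obs_outcome Y A t \<omega> - arm_mean M Y a)"

text \<open>Both forms are needed: with the observed outcome, past noise is a function of the
  history; with the potential outcome, the current noise is a function of \<open>Pot t\<close> apart
  from the action indicator.\<close>

lemma noise_eq: "noise a t \<omega> = of_bool (A t \<omega> = a) * (Y t a \<omega> - arm_mean M Y a)"
  by (auto simp: obs_outcome_def)

text \<open>For s < t the product of two noise terms splits into a history factor, the current
  action indicator and the centred potential outcome; the last factors out with mean 0. Second
  moments are bounded by the variance in round 1.\<close>

lemma noise_weak_law:
  assumes a: "a \<in> {1..K}"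
    and unconf: "unconfounded M K X Y A \<pi>"
    and hb: "history_based M K X Y A \<pi>"
    and sq: "integrable M (\<lambda>\<omega>. (Y 1 a \<omega>)\<^sup>2)"
    and \<delta>: "0 < \<delta>"
  shows "(\<lambda>t. prob {\<omega> \<in> space M. \<delta> * real t \<le> \<bar>\<Sum>\<tau>=1..t. noise a \<tau> \<omega>\<bar>}) \<longlonglongrightarrow> 0"
proof (rule weak_law_orthogonal[OF _ _ _ _ \<delta>])
  let ?\<mu> = "arm_mean M Y a"
  have Y1: "Y 1 a \<in> borel_measurable M" using Y_measurable a by simp
  have intY1: "integrable M (Y 1 a)" by (rule square_integrable_imp_integrable[OF Y1 sq])
  have sq1: "integrable M (\<lambda>\<omega>. (Y 1 a \<omega> - ?\<mu>)\<^sup>2)"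
    using sq intY1 by (simp add: power2_diff)
  have sqt: "integrable M (\<lambda>\<omega>. (Y t a \<omega> - ?\<mu>)\<^sup>2)" if "t \<ge> 1" for t
    using expectation_Y_ident(2)[OF that a, of "\<lambda>y. (y - ?\<mu>)\<^sup>2"] sq1 by simp
  have intY: "integrable M (Y t a)" if "t \<ge> 1" for t
    using expectation_Y_ident(2)[OF that a, of "\<lambda>y. y"] intY1 by simp
  show nM: "noise a t \<in> borel_measurable M" if "t \<ge> 1" for t
    using that obs_outcome_measurable[OF that] by simp
  have le: "(noise a t \<omega>)\<^sup>2 \<le> (Y t a \<omega> - ?\<mu>)\<^sup>2" for t \<omega>
    unfolding noise_eq by (simp add: power_mult_distrib)
  show nsq: "integrable M (\<lambda>\<omega>. (noise a t \<omega>)\<^sup>2)" if t: "t \<ge> 1" for t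
    by (rule Bochner_Integration.integrable_bound[OF sqt[OF t]]) (use nM[OF t] le in auto)
  show "expectation (\<lambda>\<omega>. (noise a t \<omega>)\<^sup>2) \<le> variance (Y 1 a)" if t: "t \<ge> 1" for t
  proof -
    have "expectation (\<lambda>\<omega>. (noise a t \<omega>)\<^sup>2) \<le> expectation (\<lambda>\<omega>. (Y t a \<omega> - ?\<mu>)\<^sup>2)"
      by (intro integral_mono nsq sqt le t)
    also have "\<dots> = variance (Y 1 a)"
      using expectation_Y_ident(1)[OF t a, of "\<lambda>y. (y - ?\<mu>)\<^sup>2"] by (simp add: arm_mean_def)
    finally show ?thesis .
  qed
  show "expectation (\<lambda>\<omega>. noise a s \<omega> * noise a t \<omega>) = 0" if s: "1 \<le> s" and st: "s < t" for s t
  proof -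
    have t: "1 \<le> t" using s st by simp
    have "expectation (\<lambda>\<omega>. noise a s \<omega> * noise a t \<omega>)
        = expectation (\<lambda>\<omega>. noise a s \<omega> * of_bool (A t \<omega> = a) * (Y t a \<omega> - ?\<mu>))"
      unfolding noise_eq[of t] by (simp add: mult.assoc)
    also have "\<dots> = expectation (\<lambda>\<omega>. noise a s \<omega> * of_bool (A t \<omega> = a)) * expectation (\<lambda>\<omega>. Y t a \<omega> - ?\<mu>)"
    proof (rule expectation_Hist_action_Pot[OF t a unconf])
      show "(\<lambda>\<omega>. \<pi> t \<omega> a) \<in> borel_measurable (Hist (t - 1))"
        using hb t a by (auto simp: history_based_def)
      have "s \<le> t - 1" using st by simp
      from history_components_measurable(1,2)[OF s this]
      show "noise a s \<in> borel_measurable (Hist (t - 1))" by simp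
      show "integrable M (noise a s)"
        by (rule square_integrable_imp_integrable[OF nM[OF s] nsq[OF s]])
      show "(\<lambda>\<omega>. Y t a \<omega> - ?\<mu>) \<in> borel_measurable (Pot t)"
        using Y_measurable_Pot[OF t a] by simp
      show "integrable M (\<lambda>\<omega>. Y t a \<omega> - ?\<mu>)" using intY[OF t] by simp
    qed
    also have "expectation (\<lambda>\<omega>. Y t a \<omega> - ?\<mu>) = 0"
      using intY[OF t] expectation_Y_ident(1)[OF t a, of "\<lambda>y. y"]
      by (simp add: arm_mean_def prob_space)
    finally show ?thesis by simp
  qed
qed

text \<open>Past differences are measurable in the history, so the cross terms vanish by
  \<open>integral_action_policy\<close>; differences bounded by 1 supply
  \<open>V = 1\<close>.\<close>

lemma action_weak_law:
  assumes a: "a \<in> {1..K}" and \<delta>: "0 < \<delta>"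
  shows "(\<lambda>t. prob {\<omega> \<in> space M. \<delta> * real t \<le> \<bar>\<Sum>\<tau>=1..t. of_bool (A \<tau> \<omega> = a) - \<pi> \<tau> \<omega> a\<bar>}) \<longlonglongrightarrow> 0"
proof (rule weak_law_orthogonal[OF _ _ _ _ \<delta>, where V=1])
  let ?D = "\<lambda>t \<omega>. of_bool (A t \<omega> = a) - \<pi> t \<omega> a :: real"
  show DM: "?D t \<in> borel_measurable M" if "t \<ge> 1" for t
    using policy_measurable[OF that a] that by simp
  have D1: "\<bar>?D t \<omega>\<bar> \<le> 1" if "t \<ge> 1" "\<omega> \<in> space M" for t \<omega>
    using policy_bounds[OF that a] by (auto simp: of_bool_def)
  have Dsq: "(?D t \<omega>)\<^sup>2 \<le> 1" if "t \<ge> 1" "\<omega> \<in> space M" for t \<omega>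
    using D1[OF that] by (simp add: abs_square_le_1)
  show Dint: "integrable M (\<lambda>\<omega>. (?D t \<omega>)\<^sup>2)" if "t \<ge> 1" for t
    using DM[OF that] Dsq[OF that] by (intro integrable_const_bound[where B=1]) auto
  show "expectation (\<lambda>\<omega>. (?D t \<omega>)\<^sup>2) \<le> 1" if "t \<ge> 1" for t
    using Dint[OF that] Dsq[OF that] by (intro integral_le_const) auto
  show "expectation (\<lambda>\<omega>. ?D s \<omega> * ?D t \<omega>) = 0" if s: "1 \<le> s" and st: "s < t" for s t
  proof -
    have t: "1 \<le> t" using s st by simp
    have "s \<le> t - 1" using st by simp
    note h = history_components_measurable[OF s this]
    have DF: "?D s \<in> borel_measurable (HistCtx t)"
      using h(1) h(3)[OF a] by (intro measurable_Hist_HistCtx[OF t]) simp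
    have i: "integrable M (\<lambda>\<omega>. ?D s \<omega> * of_bool (A t \<omega> = a))"
      using DM[OF s] t D1[OF s] by (intro integrable_const_bound[where B=1]) auto
    have "\<bar>?D s \<omega> * \<pi> t \<omega> a\<bar> \<le> 1" if "\<omega> \<in> space M" for \<omega>
      using mult_mono[OF D1[OF s that], of "\<bar>\<pi> t \<omega> a\<bar>" 1] policy_bounds[OF t that a] by (simp add: abs_mult)
    then have i': "integrable M (\<lambda>\<omega>. ?D s \<omega> * \<pi> t \<omega> a)"
      using DM[OF s] policy_measurable[OF t a]
      by (intro integrable_const_bound[where B=1]) (auto intro!: AE_I2)
    have "expectation (\<lambda>\<omega>. ?D s \<omega> * ?D t \<omega>)
        = expectation (\<lambda>\<omega>. ?D s \<omega> * of_bool (A t \<omega> = a) - ?D s \<omega> * \<pi> t \<omega> a)"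
      by (simp add: right_diff_distrib)
    also have "\<dots> = expectation (\<lambda>\<omega>. ?D s \<omega> * of_bool (A t \<omega> = a)) - expectation (\<lambda>\<omega>. ?D s \<omega> * \<pi> t \<omega> a)"
      by (rule Bochner_Integration.integral_diff[OF i i'])
    also have "\<dots> = 0"
      using integral_action_policy[OF t a DF i] by simp
    finally show ?thesis .
  qed
qed

section \<open>The good event and the reduction to it\<close>

definition good_event :: "real \<Rightarrow> real \<Rightarrow> nat \<Rightarrow> 'w \<Rightarrow> bool" where
  "good_event q \<eta> t \<omega> \<longleftrightarrow> (\<forall>a\<in>{1..K}. q / 2 * real t \<le> pull_count A a t \<omega> \<and>
     \<bar>\<Sum>\<tau>=1..t. noise a \<tau> \<omega>\<bar> \<le> \<eta> * real t)"

text \<open>The bound covers every subset \<open>S\<close> of the bad set because the sets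
  \<open>D\<close> and \<open>N\<close> covering it are measurable; deviation events of a policy can
  be inserted directly.\<close>

lemma good_event_prob:
  assumes unconf: "unconfounded M K X Y A \<pi>"
    and hb: "history_based M K X Y A \<pi>"
    and sq: "\<And>a. a \<in> {1..K} \<Longrightarrow> integrable M (\<lambda>\<omega>. (Y 1 a \<omega>)\<^sup>2)"
    and q: "0 < q" and \<eta>: "0 < \<eta>"
    and low: "\<And>t \<omega> a. t \<ge> 1 \<Longrightarrow> \<omega> \<in> space M \<Longrightarrow> a \<in> {1..K} \<Longrightarrow> q \<le> \<pi> t \<omega> a"
  shows "\<exists>p. p \<longlonglongrightarrow> 0 \<and> (\<forall>t. \<forall>S \<subseteq> {\<omega> \<in> space M. \<not> good_event q \<eta> t \<omega>}. prob S \<le> p t)"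
proof -
  define D where "D a t = {\<omega> \<in> space M. q / 2 * real t \<le> \<bar>\<Sum>\<tau>=1..t. of_bool (A \<tau> \<omega> = a) - \<pi> \<tau> \<omega> a\<bar>}" for a t
  define N where "N a t = {\<omega> \<in> space M. \<eta> * real t \<le> \<bar>\<Sum>\<tau>=1..t. noise a \<tau> \<omega>\<bar>}" for a t
  have DM: "D a t \<in> events" if "a \<in> {1..K}" for a t
  proof -
    have [measurable]: "(\<lambda>\<omega>. \<Sum>\<tau>=1..t. of_bool (A \<tau> \<omega> = a) - \<pi> \<tau> \<omega> a) \<in> borel_measurable M"
      using that by (intro borel_measurable_sum borel_measurable_diff action_indicator_measurable
          policy_measurable) auto
    show ?thesis unfolding D_def by measurable
  qed
  have NM: "N a t \<in> events" if "a \<in> {1..K}" for a t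
  proof -
    have [measurable]: "(\<lambda>\<omega>. \<Sum>\<tau>=1..t. noise a \<tau> \<omega>) \<in> borel_measurable M"
      using that by (intro borel_measurable_sum borel_measurable_times borel_measurable_diff
          action_indicator_measurable obs_outcome_measurable) auto
    show ?thesis unfolding N_def by measurable
  qed
  have sub: "{\<omega> \<in> space M. \<not> good_event q \<eta> t \<omega>} \<subseteq> (\<Union>a\<in>{1..K}. D a t \<union> N a t)" for t
  proof
    fix \<omega> assume "\<omega> \<in> {\<omega> \<in> space M. \<not> good_event q \<eta> t \<omega>}"
    then obtain a where \<omega>: "\<omega> \<in> space M" and a: "a \<in> {1..K}"
      and bad: "pull_count A a t \<omega> < q / 2 * real t \<or> \<eta> * real t < \<bar>\<Sum>\<tau>=1..t. noise a \<tau> \<omega>\<bar>"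
      unfolding good_event_def by (auto simp: not_le)
    \<comment> \<open>The policy values sum to at least q t, so a count below half of this forces a
      deviation of at least q t / 2 and puts the point into \<open>D\<close>.\<close>
    have "q * real t = (\<Sum>\<tau>=1..t. q)" by simp
    also have "\<dots> \<le> (\<Sum>\<tau>=1..t. \<pi> \<tau> \<omega> a)"
      using \<omega> a by (intro sum_mono low) auto
    finally have "(\<Sum>\<tau>=1..t. of_bool (A \<tau> \<omega> = a) - \<pi> \<tau> \<omega> a) \<le> pull_count A a t \<omega> - q * real t"
      by (simp add: pull_count_def sum_subtractf)
    with bad \<omega> have "\<omega> \<in> D a t \<union> N a t"
      unfolding D_def N_def by auto
    with a show "\<omega> \<in> (\<Union>a\<in>{1..K}. D a t \<union> N a t)" by blast
  qed
  have "prob S \<le> (\<Sum>a=1..K. prob (D a t) + prob (N a t))"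
    if "S \<subseteq> {\<omega> \<in> space M. \<not> good_event q \<eta> t \<omega>}" for S t
  proof -
    have "prob S \<le> prob (\<Union>a\<in>{1..K}. D a t \<union> N a t)"
      using that sub[of t] DM NM by (intro finite_measure_mono) auto
    also have "\<dots> \<le> (\<Sum>a=1..K. prob (D a t \<union> N a t))"
      using DM NM by (intro finite_measure_subadditive_finite) auto
    also have "\<dots> \<le> (\<Sum>a=1..K. prob (D a t) + prob (N a t))"
      using DM NM by (intro sum_mono measure_Un_le) auto
    finally show ?thesis .
  qed
  moreover have "(\<lambda>t. \<Sum>a=1..K. prob (D a t) + prob (N a t)) \<longlonglongrightarrow> 0"
  proof (rule tendsto_null_sum)
    fix a assume a: "a \<in> {1..K}"
    show "(\<lambda>t. prob (D a t) + prob (N a t)) \<longlonglongrightarrow> 0"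
      unfolding D_def N_def
      using tendsto_add[OF action_weak_law[OF a, of "q / 2"] noise_weak_law[OF a unconf hb sq[OF a] \<eta>]] q
      by simp
  qed
  ultimately show ?thesis by blast
qed

text \<open>Exact equality with the limit on the good event puts the deviation event into the bad
  event, whatever the tolerance \<open>e\<close>. The limit vector does not vary with the context,
  so a constant map is the stationary policy.\<close>

lemma policy_converges_vertex:
  assumes unconf: "unconfounded M K X Y A \<pi>"
    and hb: "history_based M K X Y A \<pi>"
    and sq: "\<And>a. a \<in> {1..K} \<Longrightarrow> integrable M (\<lambda>\<omega>. (Y 1 a \<omega>)\<^sup>2)"
    and q: "0 < q" "real K * q < 1" and \<eta>: "0 < \<eta>" and b: "b \<in> {1..K}"
    and low: "\<And>t \<omega> a. t \<ge> 1 \<Longrightarrow> \<omega> \<in> space M \<Longrightarrow> a \<in> {1..K} \<Longrightarrow> q \<le> \<pi> t \<omega> a"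
    and limit: "\<forall>\<^sub>F t in sequentially. \<forall>\<omega>\<in>space M. good_event q \<eta> (t - 1) \<omega> \<longrightarrow>
        (\<forall>a\<in>{1..K}. \<pi> t \<omega> a = (if a = b then 1 - (real K - 1) * q else q))"
  shows "policy_converges M K \<X> X \<pi>"
proof -
  define \<rho> where "\<rho> a = (if a = b then 1 - (real K - 1) * q else q)" for a
  have "(\<Sum>a=1..K. \<rho> a) = \<rho> b + (\<Sum>a\<in>{1..K} - {b}. q)"
    using b by (subst sum.remove[of _ b]) (auto simp: \<rho>_def intro!: sum.cong)
  also have "\<dots> = 1"
    using b by (simp add: \<rho>_def of_nat_diff)
  finally have "\<rho> \<in> prob_simplex K"
    using q by (auto simp: prob_simplex_def \<rho>_def algebra_simps)
  then have "stationary_policy K \<X> (\<lambda>_. \<rho>)"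
    by (simp add: stationary_policy_def)
  moreover have "\<forall>a\<in>{1..K}. conv_in_prob M (\<lambda>t \<omega>. \<pi> t \<omega> a - \<rho> a) (\<lambda>_. 0)"
    unfolding conv_in_prob_def
  proof (intro ballI allI impI)
    fix a and e :: real assume a: "a \<in> {1..K}" and e: "0 < e"
    let ?E = "\<lambda>t. {\<omega> \<in> space M. e < \<bar>\<pi> t \<omega> a - \<rho> a - 0\<bar>}"
    obtain p where p: "p \<longlonglongrightarrow> 0"
      and le: "\<And>t S. S \<subseteq> {\<omega> \<in> space M. \<not> good_event q \<eta> t \<omega>} \<Longrightarrow> prob S \<le> p t"
      using good_event_prob[OF unconf hb sq q(1) \<eta> low] by blast
    \<comment> \<open>The policy of round \<open>t\<close> is governed by the good event of round t
      - 1.\<close>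
    have p0: "(\<lambda>t. p (t - 1)) \<longlonglongrightarrow> 0"
      by (rule LIMSEQ_imp_Suc) (use p in simp)
    have ev: "\<forall>\<^sub>F t in sequentially. prob (?E t) \<le> p (t - 1)"
      using limit
    proof eventually_elim
      case (elim t)
      show ?case
        by (rule le) (use elim a e in \<open>auto simp: \<rho>_def\<close>)
    qed
    show "(\<lambda>t. prob (?E t)) \<longlonglongrightarrow> 0"
      by (rule real_tendsto_sandwich[OF _ ev tendsto_const p0]) simp
  qed
  ultimately show ?thesis
    unfolding policy_converges_def by blast
qed

text \<open>A positive count takes the convention \<open>c\<close> out of play. The estimation error
  is then the noise sum over the count, at most \<eta> t over q t / 2.\<close>

lemma good_event_sample_mean:
  assumes good: "good_event q \<eta> t \<omega>" and q: "0 < q" and t: "1 \<le> t" and a: "a \<in> {1..K}"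
  shows "0 < pull_count A a t \<omega>"
    and "\<bar>sample_mean c Y A a t \<omega> - arm_mean M Y a\<bar> \<le> 2 * \<eta> / q"
proof -
  let ?N = "pull_count A a t \<omega>"
  have N: "q / 2 * real t \<le> ?N" and S: "\<bar>\<Sum>\<tau>=1..t. noise a \<tau> \<omega>\<bar> \<le> \<eta> * real t"
    using good a by (auto simp: good_event_def)
  have qt: "0 < q / 2 * real t" using q t by simp
  with N show N0: "0 < ?N" by linarith
  have "(\<Sum>\<tau>=1..t. noise a \<tau> \<omega>)
      = (\<Sum>\<tau>=1..t. of_bool (A \<tau> \<omega> = a) * obs_outcome Y A \<tau> \<omega>) - ?N * arm_mean M Y a"
    by (simp add: pull_count_def right_diff_distrib sum_subtractf sum_distrib_right)
  then have "sample_mean c Y A a t \<omega> - arm_mean M Y a = (\<Sum>\<tau>=1..t. noise a \<tau> \<omega>) / ?N"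
    using N0 by (simp add: sample_mean_def field_simps)
  also have "\<bar>\<dots>\<bar> \<le> (\<eta> * real t) / (q / 2 * real t)"
    unfolding abs_divide using N0 qt N S by (intro frac_le) auto
  also have "\<dots> = 2 * \<eta> / q" using t by simp
  finally show "\<bar>sample_mean c Y A a t \<omega> - arm_mean M Y a\<bar> \<le> 2 * \<eta> / q" .
qed

section \<open>Convergence of each of the three policies\<close>

context
  fixes c :: "nat \<Rightarrow> nat \<Rightarrow> 'w \<Rightarrow> real" and b :: nat and \<Delta> :: real
  assumes unconf: "unconfounded M K X Y A \<pi>"
    and sq: "\<And>a. a \<in> {1..K} \<Longrightarrow> integrable M (\<lambda>\<omega>. (Y 1 a \<omega>)\<^sup>2)"
    and b: "b \<in> {1..K}" and \<Delta>: "0 < \<Delta>"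
    and gap: "\<And>i. i \<in> {1..K} \<Longrightarrow> i \<noteq> b \<Longrightarrow> arm_mean M Y i + \<Delta> \<le> arm_mean M Y b"
begin

lemma eps_greedy_converges:
  assumes eg: "eps_greedy M K X Y A \<pi> c \<epsilon>" and eps: "0 < \<epsilon>" "\<epsilon> < 1"
  shows "policy_converges M K \<X> X \<pi>"
proof -
  define q where "q = \<epsilon> / real K"
  define \<eta> where "\<eta> = q * \<Delta> / 8"
  have K: "0 < real K" using K_pos by simp
  have q: "0 < q" "real K * q < 1" using eps K by (auto simp: q_def)
  have \<eta>: "0 < \<eta>" "2 * \<eta> / q = \<Delta> / 4" using q \<Delta> by (auto simp: \<eta>_def)
  have pol: "\<exists>g. is_arg_max (\<lambda>i. sample_mean c Y A i (t - 1) \<omega>) (\<lambda>i. i \<in> {1..K}) g \<and>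
      (\<forall>a\<in>{1..K}. \<pi> t \<omega> a = (if a = g then 1 - (real K - 1) * q else q))"
    if "t \<ge> 1" "\<omega> \<in> space M" for t \<omega>
  proof -
    have "(real K - 1) / real K * \<epsilon> = (real K - 1) * q" by (simp add: q_def)
    from eg[unfolded eps_greedy_def this q_def[symmetric]] that show ?thesis by blast
  qed
  show ?thesis
  proof (rule policy_converges_vertex[OF unconf _ sq q \<eta>(1) b])
    show "history_based M K X Y A \<pi>" using eg by (simp add: eps_greedy_def)
    show "q \<le> \<pi> t \<omega> a" if "t \<ge> 1" "\<omega> \<in> space M" "a \<in> {1..K}" for t \<omega> a
      using pol[OF that(1,2)] that(3) q by (auto simp: algebra_simps)
    show "\<forall>\<^sub>F t in sequentially. \<forall>\<omega>\<in>space M. good_event q \<eta> (t - 1) \<omega> \<longrightarrow>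
        (\<forall>a\<in>{1..K}. \<pi> t \<omega> a = (if a = b then 1 - (real K - 1) * q else q))"
      \<comment> \<open>From round 2 on at least one observation precedes the decision, as
        \<open>good_event_sample_mean\<close> requires.\<close>
      using eventually_ge_at_top[of 2]
    proof (eventually_elim, intro ballI impI)
      fix t \<omega> a assume t: "2 \<le> t" and \<omega>: "\<omega> \<in> space M" and good: "good_event q \<eta> (t - 1) \<omega>"
        and a: "a \<in> {1..K}"
      from t \<omega> obtain g where g: "is_arg_max (\<lambda>i. sample_mean c Y A i (t - 1) \<omega>) (\<lambda>i. i \<in> {1..K}) g"
        and \<pi>: "\<forall>a\<in>{1..K}. \<pi> t \<omega> a = (if a = g then 1 - (real K - 1) * q else q)"
        using pol[of t \<omega>] by auto
      have "g = b"
        by (rule arg_max_perturbed[where \<mu>="arm_mean M Y", OF g b _ gap \<Delta>])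
          (use good_event_sample_mean(2)[OF good q(1)] t \<eta>(2) in auto)
      with \<pi> a show "\<pi> t \<omega> a = (if a = b then 1 - (real K - 1) * q else q)" by simp
    qed
  qed
qed

lemma ucb_converges:
  assumes ucb: "ucb_policy M K X Y A \<pi> c C q" and q: "0 < q" "real K * q < 1"
    and C: "(\<lambda>t. C t / real t) \<longlonglongrightarrow> 0"
  shows "policy_converges M K \<X> X \<pi>"
proof -
  \<comment> \<open>Error budget \<Delta>/4: one half for the sample mean through \<eta>, one half
    for the exploration bonus, whose bound is sqrt (d / (q/4)) = \<Delta>/8 by the choice of
    \<open>d\<close>.\<close>
  define \<eta> where "\<eta> = q * \<Delta> / 16"
  define d where "d = q / 4 * (\<Delta> / 8)\<^sup>2"
  have \<eta>: "0 < \<eta>" "2 * \<eta> / q = \<Delta> / 8" using q \<Delta> by (auto simp: \<eta>_def)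
  have d: "0 < d" using q \<Delta> by (simp add: d_def)
  have pol: "\<exists>g. is_arg_max (\<lambda>i. ucb_index c Y A C i t \<omega>) (\<lambda>i. i \<in> {1..K}) g \<and>
      (\<forall>a\<in>{1..K}. \<pi> t \<omega> a = (if a = g then 1 - (real K - 1) * q else q))"
    if "t \<ge> 1" "\<omega> \<in> space M" for t \<omega>
    using ucb that by (simp add: ucb_policy_def)
  have "\<forall>\<^sub>F t in sequentially. \<bar>C t / real t\<bar> < d"
    using tendstoD[OF C d] by (simp add: dist_real_def)
  then have ev: "\<forall>\<^sub>F t in sequentially. \<bar>C t / real t\<bar> < d \<and> 2 \<le> t"
    using eventually_ge_at_top[of 2] by (rule eventually_conj)
  show ?thesis
  proof (rule policy_converges_vertex[OF unconf _ sq q \<eta>(1) b])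
    show "history_based M K X Y A \<pi>" using ucb by (simp add: ucb_policy_def)
    show "q \<le> \<pi> t \<omega> a" if "t \<ge> 1" "\<omega> \<in> space M" "a \<in> {1..K}" for t \<omega> a
      using pol[OF that(1,2)] that(3) q by (auto simp: algebra_simps)
    show "\<forall>\<^sub>F t in sequentially. \<forall>\<omega>\<in>space M. good_event q \<eta> (t - 1) \<omega> \<longrightarrow>
        (\<forall>a\<in>{1..K}. \<pi> t \<omega> a = (if a = b then 1 - (real K - 1) * q else q))"
      using ev
    proof (eventually_elim, intro ballI impI)
      fix t \<omega> a assume t: "\<bar>C t / real t\<bar> < d \<and> 2 \<le> t" and \<omega>: "\<omega> \<in> space M"
        and good: "good_event q \<eta> (t - 1) \<omega>" and a: "a \<in> {1..K}"
      have t1: "1 \<le> t - 1" using t by linarith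
      from t \<omega> obtain g where g: "is_arg_max (\<lambda>i. ucb_index c Y A C i t \<omega>) (\<lambda>i. i \<in> {1..K}) g"
        and \<pi>: "\<forall>a\<in>{1..K}. \<pi> t \<omega> a = (if a = g then 1 - (real K - 1) * q else q)"
        using pol[of t \<omega>] by auto
      have "\<bar>ucb_index c Y A C i t \<omega> - arm_mean M Y i\<bar> \<le> \<Delta> / 4" if i: "i \<in> {1..K}" for i
      proof -
        let ?N = "pull_count A i (t - 1) \<omega>"
        note sm = good_event_sample_mean[OF good q(1) t1 i]
        \<comment> \<open>Trades the count bound in t - 1 for one in t, to match C t / t; this is
          where the factor q/4 in \<open>d\<close> comes from.\<close>
        have "real t \<le> 2 * real (t - 1)" using t by (simp add: of_nat_diff)
        then have "q / 4 * real t \<le> q / 2 * real (t - 1)" using q by simp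
        also have "\<dots> \<le> ?N" using good i by (simp add: good_event_def)
        finally have N: "q / 4 * real t \<le> ?N" .
        have "\<bar>C t / ?N\<bar> = \<bar>C t\<bar> / ?N" using sm(1) by (simp add: abs_divide)
        \<comment> \<open>\<open>C t\<close> may be negative; the real \<open>sqrt\<close> is odd,
          so the absolute value moves inside.\<close>
        then have "\<bar>sqrt (C t / ?N)\<bar> = sqrt (\<bar>C t\<bar> / ?N)"
          using real_sqrt_abs'[of "C t / ?N"] by metis
        also have "\<dots> \<le> sqrt ((d * real t) / (q / 4 * real t))"
          using t q d N by (intro real_sqrt_le_mono frac_le) (auto simp: field_simps)
        also have "(d * real t) / (q / 4 * real t) = (\<Delta> / 8)\<^sup>2"
          using t q by (simp add: d_def)
        also have "sqrt \<dots> = \<Delta> / 8" using \<Delta> by simp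
        finally have "\<bar>sqrt (C t / ?N)\<bar> \<le> \<Delta> / 8" .
        moreover have "ucb_index c Y A C i t \<omega> = sample_mean c Y A i (t - 1) \<omega> + sqrt (C t / ?N)"
          using sm(1) by (simp add: ucb_index_def)
        ultimately show ?thesis using sm(2)[of c] unfolding \<eta>(2) by linarith
      qed
      then have "g = b"
        by (rule arg_max_perturbed[where \<mu>="arm_mean M Y", OF g b _ gap \<Delta>])
      with \<pi> a show "\<pi> t \<omega> a = (if a = b then 1 - (real K - 1) * q else q)" by simp
    qed
  qed
qed

lemma thompson_converges:
  assumes ts: "thompson_policy M K X Y A \<pi> c \<mu>0 \<sigma>0 \<sigma> q" and q: "0 < q" "real K * q < 1"
    and prior: "0 < \<sigma>0" "0 < \<sigma>"
  shows "policy_converges M K \<X> X \<pi>"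
proof -
  \<comment> \<open>Again \<Delta>/8 goes to the sample mean; the other \<Delta>/8 covers the pull
    of the prior on the posterior mean, bounded by \<open>bias i / n t\<close>, where
    \<open>n t\<close> is the guaranteed number of plays.\<close>
  define \<eta> where "\<eta> = q * \<Delta> / 16"
  define n where "n t = q / 2 * real (t - 1)" for t
  define bias where "bias i = \<sigma>\<^sup>2 / \<sigma>0\<^sup>2 * \<bar>\<mu>0 - arm_mean M Y i\<bar>" for i
  have \<eta>: "0 < \<eta>" "2 * \<eta> / q = \<Delta> / 8" using q \<Delta> by (auto simp: \<eta>_def)
  have pol: "\<pi> t \<omega> a = clip K q (ts_prob K c Y A \<mu>0 \<sigma>0 \<sigma> t \<omega>) a"
    if "t \<ge> 1" "\<omega> \<in> space M" "a \<in> {1..K}" for t \<omega> a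
    using ts that by (simp add: thompson_policy_def)
  have lim: "(\<lambda>t. k / n t) \<longlonglongrightarrow> 0" for k
    unfolding n_def using q by (intro tendsto_const_over_linear) simp
  have "\<forall>\<^sub>F t in sequentially. \<forall>i\<in>{1..K}. bias i / n t < \<Delta> / 8"
    using \<Delta> by (intro eventually_ball_finite ballI order_tendstoD(2)[OF lim]) auto
  \<comment> \<open>The failure bound of \<open>ts_vertex_bound\<close> with variance
    \<open>\<sigma>\<^sup>2 / n t\<close> and \<delta> = \<Delta>/4 has to fall below q/2, the
    tolerance of \<open>clip_near_vertex\<close>.\<close>
  moreover have "\<forall>\<^sub>F t in sequentially. (real K * \<sigma>\<^sup>2 / (\<Delta> / 4)\<^sup>2) / n t < q / 2"
    using q by (intro order_tendstoD(2)[OF lim]) auto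
  ultimately have ev: "\<forall>\<^sub>F t in sequentially. 2 \<le> t \<and> (\<forall>i\<in>{1..K}. bias i / n t < \<Delta> / 8) \<and>
      (real K * \<sigma>\<^sup>2 / (\<Delta> / 4)\<^sup>2) / n t < q / 2"
    using eventually_ge_at_top[of 2] by eventually_elim blast
  show ?thesis
  proof (rule policy_converges_vertex[OF unconf _ sq q \<eta>(1) b])
    show "history_based M K X Y A \<pi>" using ts by (simp add: thompson_policy_def)
    show "q \<le> \<pi> t \<omega> a" if "t \<ge> 1" "\<omega> \<in> space M" "a \<in> {1..K}" for t \<omega> a
      using pol[OF that] by (simp add: clip_def)
    show "\<forall>\<^sub>F t in sequentially. \<forall>\<omega>\<in>space M. good_event q \<eta> (t - 1) \<omega> \<longrightarrow>
        (\<forall>a\<in>{1..K}. \<pi> t \<omega> a = (if a = b then 1 - (real K - 1) * q else q))"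
      using ev
    proof (eventually_elim, intro ballI impI)
      fix t \<omega> a
      assume t: "2 \<le> t \<and> (\<forall>i\<in>{1..K}. bias i / n t < \<Delta> / 8) \<and>
          (real K * \<sigma>\<^sup>2 / (\<Delta> / 4)\<^sup>2) / n t < q / 2"
        and \<omega>: "\<omega> \<in> space M" and good: "good_event q \<eta> (t - 1) \<omega>" and a: "a \<in> {1..K}"
      have t1: "1 \<le> t - 1" using t by linarith
      have n: "0 < n t" using q t1 by (simp add: n_def)
      let ?m = "\<lambda>i. post_mean c Y A \<mu>0 \<sigma>0 \<sigma> i (t - 1) \<omega>"
      let ?v = "\<lambda>i. post_var A \<sigma>0 \<sigma> i (t - 1) \<omega>"
      have v: "0 < ?v i \<and> ?v i \<le> \<sigma>\<^sup>2 / n t" and m: "\<bar>?m i - arm_mean M Y i\<bar> \<le> \<Delta> / 4"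
        if i: "i \<in> {1..K}" for i
      proof -
        let ?N = "pull_count A i (t - 1) \<omega>" and ?\<mu> = "arm_mean M Y i"
          and ?s = "sample_mean c Y A i (t - 1) \<omega>"
        note sm = good_event_sample_mean[OF good q(1) t1 i]
        have nN: "n t \<le> ?N" using good i by (simp add: n_def good_event_def)
        define \<Lambda> where "\<Lambda> = 1 / \<sigma>0\<^sup>2 + ?N / \<sigma>\<^sup>2"
        have "n t / \<sigma>\<^sup>2 \<le> ?N / \<sigma>\<^sup>2" using nN prior by (intro divide_right_mono) auto
        then have \<Lambda>n: "n t / \<sigma>\<^sup>2 \<le> \<Lambda>" and \<Lambda>N: "?N / \<sigma>\<^sup>2 \<le> \<Lambda>" using prior by (auto simp: \<Lambda>_def add_increasing)
        have n\<sigma>: "0 < n t / \<sigma>\<^sup>2" using n prior by simp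
        with \<Lambda>n have \<Lambda>: "0 < \<Lambda>" by linarith
        have "inverse \<Lambda> \<le> inverse (n t / \<sigma>\<^sup>2)" using \<Lambda>n n\<sigma> by (intro le_imp_inverse_le) auto
        with \<Lambda> show "0 < ?v i \<and> ?v i \<le> \<sigma>\<^sup>2 / n t"
          unfolding post_var_def \<Lambda>_def[symmetric] by simp
        \<comment> \<open>Expanding the true mean with the posterior precision \<Lambda> splits the
          error into a prior part, which vanishes as \<Lambda> grows, and the sample error with a
          weight of at most 1.\<close>
        have "?m i - ?\<mu> = inverse \<Lambda> * (\<mu>0 / \<sigma>0\<^sup>2 + ?N * ?s / \<sigma>\<^sup>2) - inverse \<Lambda> * \<Lambda> * ?\<mu>"
          using \<Lambda> unfolding post_mean_def \<Lambda>_def[symmetric] by simp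
        also have "\<dots> = inverse \<Lambda> * ((\<mu>0 - ?\<mu>) / \<sigma>0\<^sup>2 + ?N / \<sigma>\<^sup>2 * (?s - ?\<mu>))"
          unfolding mult.assoc right_diff_distrib[symmetric]
          by (simp add: \<Lambda>_def algebra_simps diff_divide_distrib)
        also have "\<dots> = ((\<mu>0 - ?\<mu>) / \<sigma>0\<^sup>2) / \<Lambda> + (?N / \<sigma>\<^sup>2 / \<Lambda>) * (?s - ?\<mu>)"
          by (simp add: divide_inverse distrib_left mult_ac)
        finally have eq: "?m i - ?\<mu> = ((\<mu>0 - ?\<mu>) / \<sigma>0\<^sup>2) / \<Lambda> + (?N / \<sigma>\<^sup>2 / \<Lambda>) * (?s - ?\<mu>)" .
        have "\<bar>((\<mu>0 - ?\<mu>) / \<sigma>0\<^sup>2) / \<Lambda>\<bar> = \<bar>\<mu>0 - ?\<mu>\<bar> / \<sigma>0\<^sup>2 / \<Lambda>"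
          using \<Lambda> by (simp add: abs_divide)
        also have "\<dots> \<le> \<bar>\<mu>0 - ?\<mu>\<bar> / \<sigma>0\<^sup>2 / (n t / \<sigma>\<^sup>2)"
          using \<Lambda> \<Lambda>n n\<sigma> by (intro divide_left_mono mult_pos_pos) auto
        also have "\<dots> = bias i / n t" by (simp add: bias_def)
        also have "\<dots> \<le> \<Delta> / 8" using t i by (blast intro: less_imp_le)
        finally have 1: "\<bar>((\<mu>0 - ?\<mu>) / \<sigma>0\<^sup>2) / \<Lambda>\<bar> \<le> \<Delta> / 8" .
        have ratio: "?N / \<sigma>\<^sup>2 / \<Lambda> \<le> 1"
          using \<Lambda>N divide_le_eq_1_pos[OF \<Lambda>] by blast
        have "\<bar>(?N / \<sigma>\<^sup>2 / \<Lambda>) * (?s - ?\<mu>)\<bar> = (?N / \<sigma>\<^sup>2 / \<Lambda>) * \<bar>?s - ?\<mu>\<bar>"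
          using \<Lambda> sm(1) by (simp add: abs_mult abs_divide)
        also have "\<dots> \<le> 1 * (\<Delta> / 8)"
          using sm(2)[of c] unfolding \<eta>(2) by (intro mult_mono ratio) auto
        finally show "\<bar>?m i - ?\<mu>\<bar> \<le> \<Delta> / 4" unfolding eq using 1 by linarith
      qed
      \<comment> \<open>The gap \<Delta> less two errors of \<Delta>/4 leaves \<Delta>/2, which is 2
        \<delta> for \<delta> = \<Delta>/4.\<close>
      have sep: "?m i + 2 * (\<Delta> / 4) \<le> ?m b" if "i \<in> {1..K}" "i \<noteq> b" for i
        using gap[OF that] m[OF that(1)] m[OF b] by linarith
      have small: "real K * (\<sigma>\<^sup>2 / n t / (\<Delta> / 4)\<^sup>2) \<le> q / 2"
        using t by (simp add: ac_simps)
      have \<Delta>4: "0 < \<Delta> / 4" using \<Delta> by simp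
      note bound = ts_vertex_bound[where v="?v" and m="?m" and w="\<sigma>\<^sup>2 / n t", OF v \<Delta>4 b sep]
      have "clip K q (ts_prob K c Y A \<mu>0 \<sigma>0 \<sigma> t \<omega>) a = (if a = b then 1 - (real K - 1) * q else q)"
      proof (rule clip_near_vertex[OF q b _ _ a])
        show "1 - q / 2 \<le> ts_prob K c Y A \<mu>0 \<sigma>0 \<sigma> t \<omega> b"
          using bound(1) small by (simp add: ts_prob_def Let_def)
        show "ts_prob K c Y A \<mu>0 \<sigma>0 \<sigma> t \<omega> i \<le> q / 2" if "i \<in> {1..K}" "i \<noteq> b" for i
          using bound(2)[OF _ _ _ that] small unfolding ts_prob_def Let_def by linarith
      qed
      then show "\<pi> t \<omega> a = (if a = b then 1 - (real K - 1) * q else q)"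
        using pol[of t \<omega> a] t \<omega> a by simp
    qed
  qed
qed

end

end

theorem proposition4p2:
  fixes M :: "'w measure"
    and K :: nat
    and \<X> :: "(real ^ 'd) set"
    and X :: "nat \<Rightarrow> 'w \<Rightarrow> real ^ 'd"
    and Y :: "nat \<Rightarrow> nat \<Rightarrow> 'w \<Rightarrow> real"
    and A :: "nat \<Rightarrow> 'w \<Rightarrow> nat"
    and \<pi> :: "nat \<Rightarrow> 'w \<Rightarrow> nat \<Rightarrow> real"
    and c :: "nat \<Rightarrow> nat \<Rightarrow> 'w \<Rightarrow> real"
    and \<epsilon> \<pi>min \<sigma>Y2 \<mu>0 \<sigma>0 \<sigma> :: real
    and astar :: nat
  assumes bandit: "contextual_bandit M K \<X> X Y A \<pi>"
    and eps: "0 < \<epsilon>" "\<epsilon> < 1"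
    and pi_min: "0 < \<pi>min" "\<pi>min < 1 / real K"
    and prior: "0 < \<sigma>0" "0 < \<sigma>"
    and finite_var: "\<And>a. a \<in> {1..K} \<Longrightarrow> integrable M (\<lambda>\<omega>. (Y 1 a \<omega>)\<^sup>2)"
    and var_bound: "(SUP a\<in>{1..K}. prob_space.variance M (Y 1 a)) \<le> \<sigma>Y2"
    and unconf: "unconfounded M K X Y A \<pi>"
    and astar: "is_arg_max (arm_mean M Y) (\<lambda>a. a \<in> {1..K}) astar"
    and gap: "arm_mean M Y astar - Max (arm_mean M Y ` ({1..K} - {astar})) > 0"
  shows "(eps_greedy M K X Y A \<pi> c \<epsilon> \<longrightarrow> policy_converges M K \<X> X \<pi>) \<and>
         (\<forall>C. ((\<lambda>t. C t / real t) \<longlonglongrightarrow> 0) \<longrightarrow> ucb_policy M K X Y A \<pi> c C \<pi>min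
              \<longrightarrow> policy_converges M K \<X> X \<pi>) \<and>
         (thompson_policy M K X Y A \<pi> c \<mu>0 \<sigma>0 \<sigma> \<pi>min \<longrightarrow> policy_converges M K \<X> X \<pi>)"
proof -
  interpret contextual_bandit M K \<X> X Y A \<pi> by (fact bandit)
  define \<Delta> where "\<Delta> = arm_mean M Y astar - Max (arm_mean M Y ` ({1..K} - {astar}))"
  have \<Delta>: "0 < \<Delta>" using gap by (simp add: \<Delta>_def)
  have b: "astar \<in> {1..K}" using astar by (simp add: is_arg_max_def)
  \<comment> \<open>For K = 1 the maximum ranges over the empty set, but then no other arm exists
    and the claim is vacuous.\<close>
  have sep: "arm_mean M Y i + \<Delta> \<le> arm_mean M Y astar" if "i \<in> {1..K}" "i \<noteq> astar" for i
  proof -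
    have "arm_mean M Y i \<le> Max (arm_mean M Y ` ({1..K} - {astar}))"
      using that by (intro Max_ge) auto
    then show ?thesis by (simp add: \<Delta>_def)
  qed
  have q: "real K * \<pi>min < 1" using pi_min K_pos by (simp add: field_simps)
  show ?thesis
    using eps_greedy_converges[OF unconf finite_var b \<Delta> sep _ eps]
      ucb_converges[OF unconf finite_var b \<Delta> sep _ pi_min(1) q]
      thompson_converges[OF unconf finite_var b \<Delta> sep _ pi_min(1) q prior]
    by blast
qed

end
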